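(* (Generalized Concurrency Theorem.) Let $(\mathcal{C},\mathcal{M})$ be an $\mathcal{M}$-adhesive category with $\mathcal{M}$-effective unions, equipped with a class $\mathcal{E}'$ as in the context. Let $\rho_1,\rho_2$ be rules, $E=(e_1,e_2)$ an $E$-dependency relation for them and $k$ a common kernel for $\rho_1,\rho_2$ compatible with $E$, such that the generalized concurrent rule $\rho_1 *_{E,k} \rho_2$ exists. Synthesis: for every $E$-related transformation sequence $G_0 \Rightarrow_{\rho_1,m_1} G_1 \Rightarrow_{\rho_2,m_2} G_2$ there exists a direct transformation $G_0 \Rightarrow_{\rho_1 *_{E,k}\rho_2,\,m} G_2$. Analysis: given a direct transformation $G_0 \Rightarrow_{\rho_1 *_{E,k}\rho_2,\,m} G_2$, there exists an $E$-related transformation sequence $G_0 \Rightarrow_{\rho_1,m_1} G_1 \Rightarrow_{\rho_2,m_2} G_2$ with $m_1 = m\circ e_1'$ if and only if a direct transformation $G_0 \Rightarrow_{\rho_1,m_1} G_1$ with $m_1 = m\circ e_1'$ exists, i.e., if and only if $\rho_1$ is applicable at $m_1=m\circ e_1'$.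
   Context: $(\mathcal{C},\mathcal{M})$ is an $\mathcal{M}$-adhesive category: $\mathcal{M}$ is a class of monomorphisms containing all isomorphisms, closed under composition and decomposition, pushouts and pullbacks along $\mathcal{M}$-morphisms exist and $\mathcal{M}$ is stable under them, and pushouts along $\mathcal{M}$-morphisms are vertical weak van Kampen squares. $\mathcal{M}$-effective unions: whenever $B\leftarrow A\rightarrow C$ is a pullback of $\mathcal{M}$-morphisms $B\to D\leftarrow C$, the induced morphism from the pushout of $B\leftarrow A\rightarrow C$ to $D$ is in $\mathcal{M}$. $\mathcal{E}'$ is a class of pairs of morphisms with common codomain such that every pair of morphisms with common codomain factors as a pair in $\mathcal{E}'$ followed by an $\mathcal{M}$-morphism; pairs in $\mathcal{E}'$ used below consist of $\mathcal{M}$-morphisms. Rules and transformations: a rule $\rho=(L\xleftarrow{l}K\xrightarrow{r}R,\mathit{ac})$ has $l,r\in\mathcal{M}$ and a nested application condition $\mathit{ac}$ over $L$ (a tree of morphisms with Boolean combinations; $m\models \exists(a:L\to C,d)$ iff there is $q\in\mathcal{M}$ with $q\circ a=m$ and $q\models d$). Matches are $\mathcal{M}$-morphisms. A direct transformation $G\Rightarrow_{\rho,m}H$ at a match $m:L\to G$ with $m\models\mathit{ac}$ consists of a morphism $d:K\to D$ and morphisms $D\to G$, $D\to H$, $n:R\to H$ such that $(l,d)$ has pushout $G$ (with $m$) and $(r,d)$ has pushout $H$ (with comatch $n$); $\rho$ is applicable at $m$ if such a transformation exists. Concurrent rule: let $\rho_i=(L_i\xleftarrow{l_i}K_i\xrightarrow{r_i}R_i,\mathit{ac}_i)$,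 $i=1,2$. An $E$-dependency relation is a pair $(e_1:R_1\to E,e_2:L_2\to E)\in\mathcal{E}'$ such that $e_1\circ r_1$ and $e_2\circ l_2$ have pushout complements, i.e., there are $e_1'':K_1\to C_1$, $r_1':C_1\to E$ with $r_1'\circ e_1''=e_1\circ r_1$ forming a pushout square with $r_1,e_1$, and $e_2'':K_2\to C_2$, $l_2':C_2\to E$ with $l_2'\circ e_2''=e_2\circ l_2$ forming a pushout square with $l_2,e_2$. Let $L$ (with $e_1':L_1\to L$, $l_1':C_1\to L$) be the pushout of $l_1$ and $e_1''$; $R$ (with $e_2':R_2\to R$, $r_2':C_2\to R$) the pushout of $r_2$ and $e_2''$; and $K$ (with $k_1:K\to C_1$, $k_2:K\to C_2$) the pullback of $r_1'$ and $l_2'$. The $E$-concurrent rule is $\rho_1*_E\rho_2=(L\xleftarrow{l}K\xrightarrow{r}R,\mathit{ac})$ with $l=l_1'\circ k_1$, $r=r_2'\circ k_2$, $\mathit{ac}=\mathrm{Shift}(e_1',\mathit{ac}_1)\wedge\mathrm{Left}(p',\mathrm{Shift}(e_2,\mathit{ac}_2))$, $p'=(L\xleftarrow{l_1'}C_1\xrightarrow{r_1'}E)$, where Shift and Left are the standard semantics-preserving transports of nested conditions along a morphism and over a rule. Common kernel: an $\mathcal{M}$-morphism $k:K_\cap\to V$ with $\mathcal{M}$-morphisms $u_i:K_\cap\to K_i$, $v_1:V\to L_1$, $v_2:V\to R_2$ such that $v_1\circ k=l_1\circ u_1$ and $v_2\circ k=r_2\circ u_2$ are pullback squares. It is compatible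 with $E$ if $K_\cap$ with $u_1,u_2$ is a pullback of $e_1\circ r_1$ and $e_2\circ l_2$. Then there is a unique $\mathcal{M}$-morphism $p:K_\cap\to K$ with $k_i\circ p=e_i''\circ u_i$ ($i=1,2$). Generalized concurrent rule (GCR): let $K'$ with $p':V\to K'$ and $k':K\to K'$ be the pushout of $k$ along $p$; let $l':K'\to L$ be the unique morphism with $l'\circ p'=e_1'\circ v_1$, $l'\circ k'=l$, and $r':K'\to R$ the unique one with $r'\circ p'=e_2'\circ v_2$, $r'\circ k'=r$. If $l',r'\in\mathcal{M}$, the GCR is $\rho_1*_{E,k}\rho_2=(L\xleftarrow{l'}K'\xrightarrow{r'}R,\mathit{ac})$ with $\mathit{ac}$ the application condition of $\rho_1*_E\rho_2$; $k'$ is its enhancement morphism. $E$-related sequence: a sequence $G_0\Rightarrow_{\rho_1,m_1}G_1\Rightarrow_{\rho_2,m_2}G_2$ with first step given by $d_1:K_1\to D_1$, $D_1\to G_1$ and comatch $n_1:R_1\to G_1$, and second step by $d_2:K_2\to D_2$, $D_2\to G_1$, is $E$-related if there exist $h:E\to G_1$, $c_1:C_1\to D_1$, $c_2:C_2\to D_2$ with $h\circ e_1=n_1$, $h\circ e_2=m_2$, $c_1\circ e_1''=d_1$, $c_2\circ e_2''=d_2$, such that the squares formed by $r_1',h,c_1,D_1\to G_1$ and by $l_2',h,c_2,D_2\to G_1$ are pushouts.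
   Formalization: In the definition of an E-related sequence the morphism h: E → G_1 is additionally required to lie in M; without this, Synthesis fails (in sets with injections, h may identify elements of E, leaving no M-match for the generalized concurrent rule). *)

theory Defs
  imports Main
begin

section \<open>Categories\<close>

record ('o, 'a) category =
  Obj :: "'o set"
  Arr :: "'a set"
  Dom :: "'a \<Rightarrow> 'o"
  Cod :: "'a \<Rightarrow> 'o"
  Id :: "'o \<Rightarrow> 'a"
  Comp :: "'a \<Rightarrow> 'a \<Rightarrow> 'a"  (infixr "\<cdot>\<index>" 70)

text \<open>Composition is in applicative order: \<open>g \<cdot> f\<close> is \<open>f\<close> followed by \<open>g\<close>. It is a total
  function of the logic, so composability is always stated separately.\<close>

locale category =
  fixes C :: "('o, 'a) category" (structure)
  assumes Dom_in: "f \<in> Arr C \<Longrightarrow> Dom C f \<in> Obj C"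
    and Cod_in: "f \<in> Arr C \<Longrightarrow> Cod C f \<in> Obj C"
    and Id_in: "X \<in> Obj C \<Longrightarrow> Id C X \<in> Arr C"
    and Dom_Id: "X \<in> Obj C \<Longrightarrow> Dom C (Id C X) = X"
    and Cod_Id: "X \<in> Obj C \<Longrightarrow> Cod C (Id C X) = X"
    and Comp_in: "f \<in> Arr C \<Longrightarrow> g \<in> Arr C \<Longrightarrow> Cod C f = Dom C g \<Longrightarrow> g \<cdot> f \<in> Arr C"
    and Dom_Comp: "f \<in> Arr C \<Longrightarrow> g \<in> Arr C \<Longrightarrow> Cod C f = Dom C g \<Longrightarrow> Dom C (g \<cdot> f) = Dom C f"
    and Cod_Comp: "f \<in> Arr C \<Longrightarrow> g \<in> Arr C \<Longrightarrow> Cod C f = Dom C g \<Longrightarrow> Cod C (g \<cdot> f) = Cod C g"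
    and Comp_Id: "f \<in> Arr C \<Longrightarrow> f \<cdot> Id C (Dom C f) = f"
    and Id_Comp: "f \<in> Arr C \<Longrightarrow> Id C (Cod C f) \<cdot> f = f"
    and Comp_assoc: "f \<in> Arr C \<Longrightarrow> g \<in> Arr C \<Longrightarrow> h \<in> Arr C \<Longrightarrow>
      Cod C f = Dom C g \<Longrightarrow> Cod C g = Dom C h \<Longrightarrow> (h \<cdot> g) \<cdot> f = h \<cdot> (g \<cdot> f)"

definition mono_arr :: "('o, 'a) category \<Rightarrow> 'a \<Rightarrow> bool" where
  "mono_arr C m \<longleftrightarrow> m \<in> Arr C \<and>
    (\<forall>f\<in>Arr C. \<forall>g\<in>Arr C. Cod C f = Dom C m \<and> Cod C g = Dom C m \<and> Dom C f = Dom C g \<and>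
      m \<cdot>\<^bsub>C\<^esub> f = m \<cdot>\<^bsub>C\<^esub> g \<longrightarrow> f = g)"

definition iso_arr :: "('o, 'a) category \<Rightarrow> 'a \<Rightarrow> bool" where
  "iso_arr C f \<longleftrightarrow> f \<in> Arr C \<and>
    (\<exists>g\<in>Arr C. Dom C g = Cod C f \<and> Cod C g = Dom C f \<and>
      g \<cdot>\<^bsub>C\<^esub> f = Id C (Dom C f) \<and> f \<cdot>\<^bsub>C\<^esub> g = Id C (Cod C f))"

text \<open>In \<open>square C f g f' g'\<close>, \<open>pushout C f g f' g'\<close> and \<open>pullback C f' g' f g\<close> the square is
  \<open>f' \<cdot> f = g' \<cdot> g\<close>; the first two arguments of \<open>pushout\<close> are the span and the first two
  arguments of \<open>pullback\<close> are the cospan.\<close>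

definition square :: "('o, 'a) category \<Rightarrow> 'a \<Rightarrow> 'a \<Rightarrow> 'a \<Rightarrow> 'a \<Rightarrow> bool" where
  "square C f g f' g' \<longleftrightarrow>
    f \<in> Arr C \<and> g \<in> Arr C \<and> f' \<in> Arr C \<and> g' \<in> Arr C \<and>
    Dom C f = Dom C g \<and> Cod C f = Dom C f' \<and> Cod C g = Dom C g' \<and> Cod C f' = Cod C g' \<and>
    f' \<cdot>\<^bsub>C\<^esub> f = g' \<cdot>\<^bsub>C\<^esub> g"

definition pushout :: "('o, 'a) category \<Rightarrow> 'a \<Rightarrow> 'a \<Rightarrow> 'a \<Rightarrow> 'a \<Rightarrow> bool" where
  "pushout C f g f' g' \<longleftrightarrow> square C f g f' g' \<and>
    (\<forall>x y. square C f g x y \<longrightarrow>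
      (\<exists>!u. u \<in> Arr C \<and> Dom C u = Cod C f' \<and> Cod C u = Cod C x \<and>
        u \<cdot>\<^bsub>C\<^esub> f' = x \<and> u \<cdot>\<^bsub>C\<^esub> g' = y))"

definition pullback :: "('o, 'a) category \<Rightarrow> 'a \<Rightarrow> 'a \<Rightarrow> 'a \<Rightarrow> 'a \<Rightarrow> bool" where
  "pullback C f g f' g' \<longleftrightarrow> square C f' g' f g \<and>
    (\<forall>x y. square C x y f g \<longrightarrow>
      (\<exists>!u. u \<in> Arr C \<and> Cod C u = Dom C f' \<and> Dom C u = Dom C x \<and>
        f' \<cdot>\<^bsub>C\<^esub> u = x \<and> g' \<cdot>\<^bsub>C\<^esub> u = y))"

definition has_pushout_complement :: "('o, 'a) category \<Rightarrow> 'a \<Rightarrow> 'a \<Rightarrow> bool" where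
  "has_pushout_complement C f f' \<longleftrightarrow> (\<exists>g g'. pushout C f g f' g')"

section \<open>M-adhesive categories\<close>

text \<open>Bottom face: \<open>m : A \<rightarrow> B\<close>, \<open>f : A \<rightarrow> X\<close>, \<open>g : B \<rightarrow> D\<close>, \<open>n : X \<rightarrow> D\<close>. The primed arrows form
  the top face, and \<open>a, b, c, d\<close> are the vertical arrows into \<open>A, B, X, D\<close>. The back faces are
  the two containing \<open>a\<close>, the front faces the two containing \<open>d\<close>. Only \<open>b, c, d\<close> have to be
  in \<open>M\<close>.\<close>

definition vertical_weak_VK ::
  "('o, 'a) category \<Rightarrow> 'a set \<Rightarrow> 'a \<Rightarrow> 'a \<Rightarrow> 'a \<Rightarrow> 'a \<Rightarrow> bool" where
  "vertical_weak_VK C M m f g n \<longleftrightarrow>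
    (\<forall>m' f' g' n' a b c d.
      b \<in> M \<and> c \<in> M \<and> d \<in> M \<and>
      pullback C b m m' a \<and> pullback C c f f' a \<and>
      square C m' f' g' n' \<and> square C g' b d g \<and> square C n' c d n \<longrightarrow>
      (pushout C m' f' g' n' \<longleftrightarrow> pullback C d g g' b \<and> pullback C d n n' c))"

locale M_adhesive_category = category C for C :: "('o, 'a) category" (structure) +
  fixes M :: "'a set"
  assumes M_mono: "m \<in> M \<Longrightarrow> mono_arr C m"
    and iso_M: "iso_arr C f \<Longrightarrow> f \<in> M"
    and M_Comp: "f \<in> M \<Longrightarrow> g \<in> M \<Longrightarrow> Cod C f = Dom C g \<Longrightarrow> g \<cdot> f \<in> M"
    and M_decomp: "f \<in> Arr C \<Longrightarrow> g \<in> M \<Longrightarrow> Cod C f = Dom C g \<Longrightarrow> g \<cdot> f \<in> M \<Longrightarrow> f \<in> M"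
    and pushout_ex: "m \<in> M \<Longrightarrow> f \<in> Arr C \<Longrightarrow> Dom C m = Dom C f \<Longrightarrow> \<exists>g n. pushout C m f g n"
    and M_pushout: "m \<in> M \<Longrightarrow> pushout C m f g n \<Longrightarrow> n \<in> M"
    and pullback_ex: "m \<in> M \<Longrightarrow> f \<in> Arr C \<Longrightarrow> Cod C m = Cod C f \<Longrightarrow> \<exists>g n. pullback C m f g n"
    and M_pullback: "m \<in> M \<Longrightarrow> pullback C m f g n \<Longrightarrow> n \<in> M"
    and VK: "m \<in> M \<Longrightarrow> pushout C m f g n \<Longrightarrow> vertical_weak_VK C M m f g n"

definition M_effective_unions :: "('o, 'a) category \<Rightarrow> 'a set \<Rightarrow> bool" where
  "M_effective_unions C M \<longleftrightarrow>
    (\<forall>b\<in>M. \<forall>c\<in>M. \<forall>p q b' c' u.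
      pullback C b c p q \<and> pushout C p q b' c' \<and>
      u \<in> Arr C \<and> Dom C u = Cod C b' \<and> Cod C u = Cod C b \<and>
      u \<cdot>\<^bsub>C\<^esub> b' = b \<and> u \<cdot>\<^bsub>C\<^esub> c' = c \<longrightarrow> u \<in> M)"

definition pair_factorization :: "('o, 'a) category \<Rightarrow> 'a set \<Rightarrow> ('a \<times> 'a) set \<Rightarrow> bool" where
  "pair_factorization C M E' \<longleftrightarrow>
    (\<forall>(f, g)\<in>E'. f \<in> Arr C \<and> g \<in> Arr C \<and> Cod C f = Cod C g) \<and>
    (\<forall>f\<in>Arr C. \<forall>g\<in>Arr C. Cod C f = Cod C g \<longrightarrow>
      (\<exists>e\<^sub>1 e\<^sub>2 m. (e\<^sub>1, e\<^sub>2) \<in> E' \<and> m \<in> M \<and> Cod C e\<^sub>1 = Dom C m \<and>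
        f = m \<cdot>\<^bsub>C\<^esub> e\<^sub>1 \<and> g = m \<cdot>\<^bsub>C\<^esub> e\<^sub>2))"

section \<open>Nested conditions\<close>

text \<open>Disjunctions indexed by sets of pairs of arrows are included because shifting an
  existential condition yields a disjunction over a possibly infinite set of pairs in \<open>E'\<close>.\<close>

datatype 'a ncond =
    CTrue
  | CEx 'a "'a ncond"
  | CNot "'a ncond"
  | CAnd "'a ncond" "'a ncond"
  | CDisj "('a \<times> 'a) set" "'a \<times> 'a \<Rightarrow> 'a ncond"

primrec cond_over :: "('o, 'a) category \<Rightarrow> 'o \<Rightarrow> 'a ncond \<Rightarrow> bool" where
  "cond_over C P CTrue \<longleftrightarrow> P \<in> Obj C"
| "cond_over C P (CEx a c) \<longleftrightarrow> a \<in> Arr C \<and> Dom C a = P \<and> cond_over C (Cod C a) c"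
| "cond_over C P (CNot c) \<longleftrightarrow> cond_over C P c"
| "cond_over C P (CAnd c c') \<longleftrightarrow> cond_over C P c \<and> cond_over C P c'"
| "cond_over C P (CDisj I c) \<longleftrightarrow> P \<in> Obj C \<and> (\<forall>i\<in>I. cond_over C P (c i))"

primrec sat :: "('o, 'a) category \<Rightarrow> 'a set \<Rightarrow> 'a \<Rightarrow> 'a ncond \<Rightarrow> bool" where
  "sat C M m CTrue \<longleftrightarrow> True"
| "sat C M m (CEx a c) \<longleftrightarrow>
    (\<exists>q\<in>M. Dom C q = Cod C a \<and> q \<cdot>\<^bsub>C\<^esub> a = m \<and> sat C M q c)"
| "sat C M m (CNot c) \<longleftrightarrow> \<not> sat C M m c"
| "sat C M m (CAnd c c') \<longleftrightarrow> sat C M m c \<and> sat C M m c'"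
| "sat C M m (CDisj I c) \<longleftrightarrow> (\<exists>i\<in>I. sat C M m (c i))"

text \<open>For \<open>b : P \<rightarrow> P'\<close>, \<open>Shift C M E' b\<close> maps conditions over \<open>P\<close> to conditions over \<open>P'\<close>.\<close>

primrec Shift ::
  "('o, 'a) category \<Rightarrow> 'a set \<Rightarrow> ('a \<times> 'a) set \<Rightarrow> 'a \<Rightarrow> 'a ncond \<Rightarrow> 'a ncond" where
  "Shift C M E' b CTrue = CTrue"
| "Shift C M E' b (CEx a c) =
    CDisj {(a', b'). (a', b') \<in> E' \<and> b' \<in> M \<and> square C a b b' a'}
      (\<lambda>i. CEx (fst i) (Shift C M E' (snd i) c))"
| "Shift C M E' b (CNot c) = CNot (Shift C M E' b c)"
| "Shift C M E' b (CAnd c c') = CAnd (Shift C M E' b c) (Shift C M E' b c')"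
| "Shift C M E' b (CDisj I c) = CDisj I (\<lambda>i. Shift C M E' b (c i))"

text \<open>For a plain rule \<open>L \<leftarrow>l\<midarrow> K \<midarrow>r\<rightarrow> R\<close>, \<open>Left C l r\<close> maps conditions over \<open>R\<close> to conditions over
  \<open>L\<close>. For \<open>a : R \<rightarrow> X\<close> one chooses a pushout complement \<open>z : K \<rightarrow> Z\<close>, \<open>r' : Z \<rightarrow> X\<close> of \<open>r\<close> and
  \<open>a\<close> and a pushout \<open>b : L \<rightarrow> Y\<close>, \<open>l' : Z \<rightarrow> Y\<close> of \<open>l\<close> and \<open>z\<close>; this gives the derived rule
  \<open>Y \<leftarrow>l'\<midarrow> Z \<midarrow>r'\<rightarrow> X\<close>, along which the inner condition is transported.\<close>

definition derived_rule ::
  "('o, 'a) category \<Rightarrow> 'a \<Rightarrow> 'a \<Rightarrow> 'a \<Rightarrow> 'a \<times> 'a \<times> 'a" where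
  "derived_rule C l r a =
    (SOME (b, l', r'). \<exists>z. pushout C r z a r' \<and> pushout C l z b l')"

primrec Left :: "('o, 'a) category \<Rightarrow> 'a \<Rightarrow> 'a \<Rightarrow> 'a ncond \<Rightarrow> 'a ncond" where
  "Left C l r CTrue = CTrue"
| "Left C l r (CEx a c) =
    (if has_pushout_complement C r a
     then (case derived_rule C l r a of (b, l', r') \<Rightarrow> CEx b (Left C l' r' c))
     else CNot CTrue)"
| "Left C l r (CNot c) = CNot (Left C l r c)"
| "Left C l r (CAnd c c') = CAnd (Left C l r c) (Left C l r c')"
| "Left C l r (CDisj I c) = CDisj I (\<lambda>i. Left C l r (c i))"

section \<open>Rules and direct transformations\<close>

text \<open>\<open>L \<leftarrow>lmor\<midarrow> K \<midarrow>rmor\<rightarrow> R\<close> with application condition over \<open>L\<close>.\<close>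

record 'a rule =
  lmor :: 'a
  rmor :: 'a
  acond :: "'a ncond"

definition is_rule :: "('o, 'a) category \<Rightarrow> 'a set \<Rightarrow> 'a rule \<Rightarrow> bool" where
  "is_rule C M \<rho> \<longleftrightarrow>
    lmor \<rho> \<in> M \<and> rmor \<rho> \<in> M \<and> Dom C (lmor \<rho>) = Dom C (rmor \<rho>) \<and>
    cond_over C (Cod C (lmor \<rho>)) (acond \<rho>)"

text \<open>Match \<open>m : L \<rightarrow> G\<close>, \<open>d : K \<rightarrow> D\<close>, \<open>g : D \<rightarrow> G\<close>, \<open>h : D \<rightarrow> H\<close> and comatch \<open>n : R \<rightarrow> H\<close>.\<close>

definition transformation_diagram ::
  "('o, 'a) category \<Rightarrow> 'a set \<Rightarrow> 'a rule \<Rightarrow> 'a \<Rightarrow> 'a \<Rightarrow> 'a \<Rightarrow> 'a \<Rightarrow> 'a \<Rightarrow> bool" where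
  "transformation_diagram C M \<rho> m d g h n \<longleftrightarrow>
    m \<in> M \<and> sat C M m (acond \<rho>) \<and>
    pushout C (lmor \<rho>) d m g \<and> pushout C (rmor \<rho>) d n h"

definition transformation ::
  "('o, 'a) category \<Rightarrow> 'a set \<Rightarrow> 'a rule \<Rightarrow> 'a \<Rightarrow> 'o \<Rightarrow> 'o \<Rightarrow> bool" where
  "transformation C M \<rho> m G H \<longleftrightarrow>
    (\<exists>d g h n. transformation_diagram C M \<rho> m d g h n \<and> Cod C g = G \<and> Cod C h = H)"

definition applicable :: "('o, 'a) category \<Rightarrow> 'a set \<Rightarrow> 'a rule \<Rightarrow> 'a \<Rightarrow> bool" where
  "applicable C M \<rho> m \<longleftrightarrow> (\<exists>d g h n. transformation_diagram C M \<rho> m d g h n)"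

section \<open>Concurrent rules\<close>

definition E_dependency_relation ::
  "('o, 'a) category \<Rightarrow> 'a set \<Rightarrow> ('a \<times> 'a) set \<Rightarrow> 'a rule \<Rightarrow> 'a rule \<Rightarrow> 'a \<Rightarrow> 'a \<Rightarrow> bool" where
  "E_dependency_relation C M E' \<rho>\<^sub>1 \<rho>\<^sub>2 e\<^sub>1 e\<^sub>2 \<longleftrightarrow>
    (e\<^sub>1, e\<^sub>2) \<in> E' \<and> e\<^sub>1 \<in> M \<and> e\<^sub>2 \<in> M \<and>
    Dom C e\<^sub>1 = Cod C (rmor \<rho>\<^sub>1) \<and> Dom C e\<^sub>2 = Cod C (lmor \<rho>\<^sub>2) \<and>
    has_pushout_complement C (rmor \<rho>\<^sub>1) e\<^sub>1 \<and> has_pushout_complement C (lmor \<rho>\<^sub>2) e\<^sub>2"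

text \<open>The arrows of the construction are arbitrary representatives of the (unique up to
  isomorphism) pushout complements, pushouts and pullback:
  \<open>e\<^sub>1'' : K\<^sub>1 \<rightarrow> C\<^sub>1\<close>, \<open>r\<^sub>1' : C\<^sub>1 \<rightarrow> E\<close>, \<open>e\<^sub>2'' : K\<^sub>2 \<rightarrow> C\<^sub>2\<close>, \<open>l\<^sub>2' : C\<^sub>2 \<rightarrow> E\<close>,
  \<open>e\<^sub>1' : L\<^sub>1 \<rightarrow> L\<close>, \<open>l\<^sub>1' : C\<^sub>1 \<rightarrow> L\<close>, \<open>e\<^sub>2' : R\<^sub>2 \<rightarrow> R\<close>, \<open>r\<^sub>2' : C\<^sub>2 \<rightarrow> R\<close>, \<open>k\<^sub>i : K \<rightarrow> C\<^sub>i\<close>.\<close>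

definition concurrent_diagram ::
  "('o, 'a) category \<Rightarrow> 'a rule \<Rightarrow> 'a rule \<Rightarrow> 'a \<Rightarrow> 'a \<Rightarrow> 'a \<Rightarrow> 'a \<Rightarrow> 'a \<Rightarrow> 'a \<Rightarrow>
    'a \<Rightarrow> 'a \<Rightarrow> 'a \<Rightarrow> 'a \<Rightarrow> 'a \<Rightarrow> 'a \<Rightarrow> bool" where
  "concurrent_diagram C \<rho>\<^sub>1 \<rho>\<^sub>2 e\<^sub>1 e\<^sub>2 e\<^sub>1'' r\<^sub>1' e\<^sub>2'' l\<^sub>2' e\<^sub>1' l\<^sub>1' e\<^sub>2' r\<^sub>2' k\<^sub>1 k\<^sub>2 \<longleftrightarrow>
    pushout C (rmor \<rho>\<^sub>1) e\<^sub>1'' e\<^sub>1 r\<^sub>1' \<and>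
    pushout C (lmor \<rho>\<^sub>2) e\<^sub>2'' e\<^sub>2 l\<^sub>2' \<and>
    pushout C (lmor \<rho>\<^sub>1) e\<^sub>1'' e\<^sub>1' l\<^sub>1' \<and>
    pushout C (rmor \<rho>\<^sub>2) e\<^sub>2'' e\<^sub>2' r\<^sub>2' \<and>
    pullback C r\<^sub>1' l\<^sub>2' k\<^sub>1 k\<^sub>2"

definition concurrent_rule ::
  "('o, 'a) category \<Rightarrow> 'a set \<Rightarrow> ('a \<times> 'a) set \<Rightarrow> 'a rule \<Rightarrow> 'a rule \<Rightarrow>
    'a \<Rightarrow> 'a \<Rightarrow> 'a \<Rightarrow> 'a \<Rightarrow> 'a \<Rightarrow> 'a \<Rightarrow> 'a \<Rightarrow> 'a rule" where
  "concurrent_rule C M E' \<rho>\<^sub>1 \<rho>\<^sub>2 e\<^sub>2 r\<^sub>1' e\<^sub>1' l\<^sub>1' r\<^sub>2' k\<^sub>1 k\<^sub>2 =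
    \<lparr> lmor = l\<^sub>1' \<cdot>\<^bsub>C\<^esub> k\<^sub>1,
      rmor = r\<^sub>2' \<cdot>\<^bsub>C\<^esub> k\<^sub>2,
      acond = CAnd (Shift C M E' e\<^sub>1' (acond \<rho>\<^sub>1))
                   (Left C l\<^sub>1' r\<^sub>1' (Shift C M E' e\<^sub>2 (acond \<rho>\<^sub>2))) \<rparr>"

section \<open>Generalized concurrent rules\<close>

definition common_kernel ::
  "('o, 'a) category \<Rightarrow> 'a set \<Rightarrow> 'a rule \<Rightarrow> 'a rule \<Rightarrow>
    'a \<Rightarrow> 'a \<Rightarrow> 'a \<Rightarrow> 'a \<Rightarrow> 'a \<Rightarrow> bool" where
  "common_kernel C M \<rho>\<^sub>1 \<rho>\<^sub>2 k u\<^sub>1 u\<^sub>2 v\<^sub>1 v\<^sub>2 \<longleftrightarrow>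
    k \<in> M \<and> u\<^sub>1 \<in> M \<and> u\<^sub>2 \<in> M \<and> v\<^sub>1 \<in> M \<and> v\<^sub>2 \<in> M \<and>
    pullback C v\<^sub>1 (lmor \<rho>\<^sub>1) k u\<^sub>1 \<and> pullback C v\<^sub>2 (rmor \<rho>\<^sub>2) k u\<^sub>2"

definition compatible_kernel ::
  "('o, 'a) category \<Rightarrow> 'a rule \<Rightarrow> 'a rule \<Rightarrow> 'a \<Rightarrow> 'a \<Rightarrow> 'a \<Rightarrow> 'a \<Rightarrow> bool" where
  "compatible_kernel C \<rho>\<^sub>1 \<rho>\<^sub>2 e\<^sub>1 e\<^sub>2 u\<^sub>1 u\<^sub>2 \<longleftrightarrow>
    pullback C (e\<^sub>1 \<cdot>\<^bsub>C\<^esub> rmor \<rho>\<^sub>1) (e\<^sub>2 \<cdot>\<^bsub>C\<^esub> lmor \<rho>\<^sub>2) u\<^sub>1 u\<^sub>2"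

definition kernel_embedding ::
  "('o, 'a) category \<Rightarrow> 'a set \<Rightarrow> 'a \<Rightarrow> 'a \<Rightarrow> 'a \<Rightarrow> 'a \<Rightarrow> 'a \<Rightarrow> 'a \<Rightarrow> 'a \<Rightarrow> bool" where
  "kernel_embedding C M e\<^sub>1'' e\<^sub>2'' k\<^sub>1 k\<^sub>2 u\<^sub>1 u\<^sub>2 p \<longleftrightarrow>
    p \<in> M \<and> Dom C p = Dom C u\<^sub>1 \<and> Cod C p = Dom C k\<^sub>1 \<and>
    k\<^sub>1 \<cdot>\<^bsub>C\<^esub> p = e\<^sub>1'' \<cdot>\<^bsub>C\<^esub> u\<^sub>1 \<and> k\<^sub>2 \<cdot>\<^bsub>C\<^esub> p = e\<^sub>2'' \<cdot>\<^bsub>C\<^esub> u\<^sub>2"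

text \<open>\<open>\<rho>\<close> is the concurrent rule \<open>L \<leftarrow> K \<rightarrow> R\<close>; \<open>p' : V \<rightarrow> K'\<close> and the enhancement morphism
  \<open>k' : K \<rightarrow> K'\<close> form the pushout of \<open>k\<close> and \<open>p\<close>; \<open>l' : K' \<rightarrow> L\<close> and \<open>r' : K' \<rightarrow> R\<close> are the
  mediating arrows.\<close>

definition gcr_diagram ::
  "('o, 'a) category \<Rightarrow> 'a set \<Rightarrow> 'a rule \<Rightarrow> 'a \<Rightarrow> 'a \<Rightarrow>
    'a \<Rightarrow> 'a \<Rightarrow> 'a \<Rightarrow> 'a \<Rightarrow> 'a \<Rightarrow> 'a \<Rightarrow> 'a \<Rightarrow> 'a \<Rightarrow> bool" where
  "gcr_diagram C M \<rho> e\<^sub>1' e\<^sub>2' k v\<^sub>1 v\<^sub>2 p p' k' l' r' \<longleftrightarrow>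
    pushout C k p p' k' \<and>
    l' \<in> M \<and> Dom C l' = Cod C k' \<and> Cod C l' = Cod C (lmor \<rho>) \<and>
    l' \<cdot>\<^bsub>C\<^esub> p' = e\<^sub>1' \<cdot>\<^bsub>C\<^esub> v\<^sub>1 \<and> l' \<cdot>\<^bsub>C\<^esub> k' = lmor \<rho> \<and>
    r' \<in> M \<and> Dom C r' = Cod C k' \<and> Cod C r' = Cod C (rmor \<rho>) \<and>
    r' \<cdot>\<^bsub>C\<^esub> p' = e\<^sub>2' \<cdot>\<^bsub>C\<^esub> v\<^sub>2 \<and> r' \<cdot>\<^bsub>C\<^esub> k' = rmor \<rho>"

definition generalized_concurrent_rule :: "'a rule \<Rightarrow> 'a \<Rightarrow> 'a \<Rightarrow> 'a rule" where
  "generalized_concurrent_rule \<rho> l' r' = \<lparr> lmor = l', rmor = r', acond = acond \<rho> \<rparr>"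

section \<open>E-related sequences\<close>

text \<open>The arrow \<open>h : E \<rightarrow> G\<^sub>1\<close> is required to be in \<open>M\<close>. This does not follow from the other
  clauses: \<open>h\<close> may identify preserved elements of \<open>R\<^sub>1\<close> and \<open>L\<^sub>2\<close> that are kept apart in \<open>E\<close>, and
  then the composed sequence has no match in \<open>M\<close> for the concurrent rule.\<close>

definition E_related ::
  "('o, 'a) category \<Rightarrow> 'a set \<Rightarrow> 'a rule \<Rightarrow> 'a rule \<Rightarrow> 'a \<Rightarrow> 'a \<Rightarrow> 'a \<Rightarrow> 'a \<Rightarrow> 'a \<Rightarrow> 'a \<Rightarrow>
    'a \<Rightarrow> 'a \<Rightarrow> 'o \<Rightarrow> 'o \<Rightarrow> 'o \<Rightarrow> bool" where
  "E_related C M \<rho>\<^sub>1 \<rho>\<^sub>2 e\<^sub>1 e\<^sub>2 e\<^sub>1'' r\<^sub>1' e\<^sub>2'' l\<^sub>2' m\<^sub>1 m\<^sub>2 G\<^sub>0 G\<^sub>1 G\<^sub>2 \<longleftrightarrow>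
    (\<exists>d\<^sub>1 g\<^sub>1 h\<^sub>1 n\<^sub>1 d\<^sub>2 g\<^sub>2 h\<^sub>2 n\<^sub>2 h c\<^sub>1 c\<^sub>2.
      transformation_diagram C M \<rho>\<^sub>1 m\<^sub>1 d\<^sub>1 g\<^sub>1 h\<^sub>1 n\<^sub>1 \<and> Cod C g\<^sub>1 = G\<^sub>0 \<and> Cod C h\<^sub>1 = G\<^sub>1 \<and>
      transformation_diagram C M \<rho>\<^sub>2 m\<^sub>2 d\<^sub>2 g\<^sub>2 h\<^sub>2 n\<^sub>2 \<and> Cod C g\<^sub>2 = G\<^sub>1 \<and> Cod C h\<^sub>2 = G\<^sub>2 \<and>
      h \<in> M \<and>
      h \<cdot>\<^bsub>C\<^esub> e\<^sub>1 = n\<^sub>1 \<and> h \<cdot>\<^bsub>C\<^esub> e\<^sub>2 = m\<^sub>2 \<and>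
      c\<^sub>1 \<cdot>\<^bsub>C\<^esub> e\<^sub>1'' = d\<^sub>1 \<and> c\<^sub>2 \<cdot>\<^bsub>C\<^esub> e\<^sub>2'' = d\<^sub>2 \<and>
      pushout C r\<^sub>1' c\<^sub>1 h h\<^sub>1 \<and> pushout C l\<^sub>2' c\<^sub>2 h g\<^sub>2)"

end

theory Submission
  imports Defs
begin

text \<open>Let \<open>D\<^sub>1\<close> and \<open>D\<^sub>2\<close> be the context objects of the two steps, \<open>D\<close> that of the concurrent rule
  and \<open>D'\<close> that of the generalized concurrent rule. In a synthesis, \<open>D\<close> is the pullback of \<open>D\<^sub>1\<close> and
  \<open>D\<^sub>2\<close> over \<open>G\<^sub>1\<close>, and \<open>D'\<close> is the pushout of \<open>K'\<close> and \<open>D\<close> over \<open>K\<close>. In an analysis, \<open>D\<^sub>1\<close> is given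
  by the applicability of the first rule, and \<open>D\<close> is the pullback of \<open>D'\<close> and \<open>D\<^sub>1\<close> over \<open>G\<^sub>0\<close>. The
  key point is that \<open>K\<close> is the pullback of \<open>K'\<close> and \<open>C\<^sub>1\<close> over \<open>L\<close>; hence the van Kampen property
  makes both \<open>D'\<close> and \<open>D\<^sub>1\<close> pushouts along \<open>K \<rightarrow> D\<close>, and \<open>D\<^sub>2\<close> is obtained as the pushout of \<open>C\<^sub>2\<close>
  and \<open>D\<close> over \<open>K\<close>. Everything else is pasting of squares.\<close>

section \<open>Pushouts and pullbacks\<close>

context category
begin

lemma squareD:
  assumes "square C f g f' g'"
  shows "f \<in> Arr C" "g \<in> Arr C" "f' \<in> Arr C" "g' \<in> Arr C"
    "Dom C f = Dom C g" "Cod C f = Dom C f'" "Cod C g = Dom C g'" "Cod C f' = Cod C g'"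
    "f' \<cdot> f = g' \<cdot> g"
  using assms by (auto simp: square_def)

lemma square_sym: "square C f g f' g' \<Longrightarrow> square C g f g' f'"
  by (auto simp: square_def)

lemma square_precomp:
  assumes "square C f g f' g'" and "x \<in> Arr C" "Cod C x = Dom C f"
  shows "f' \<cdot> (f \<cdot> x) = g' \<cdot> (g \<cdot> x)"
proof -
  note p = squareD[OF assms(1)]
  have "f' \<cdot> (f \<cdot> x) = (f' \<cdot> f) \<cdot> x" "g' \<cdot> (g \<cdot> x) = (g' \<cdot> g) \<cdot> x"
    using p(1-8) assms(2,3) by (simp_all add: Comp_assoc)
  with p(9) show ?thesis by simp
qed

lemma square_postcomp:
  assumes "square C f g f' g'" and "y \<in> Arr C" "Dom C y = Cod C f'"
  shows "(y \<cdot> f') \<cdot> f = (y \<cdot> g') \<cdot> g"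
  using squareD[OF assms(1)] assms(2,3) by (simp add: Comp_assoc)

lemma pushout_square: "pushout C f g f' g' \<Longrightarrow> square C f g f' g'"
  by (simp add: pushout_def)

lemma pullback_square: "pullback C f g f' g' \<Longrightarrow> square C f' g' f g"
  by (simp add: pullback_def)

lemmas pushoutD = squareD[OF pushout_square]
lemmas pullbackD = squareD[OF pullback_square]

lemma pushout_sym:
  assumes "pushout C f g f' g'"
  shows "pushout C g f g' f'"
  unfolding pushout_def
proof (intro conjI allI impI)
  fix x y assume s: "square C g f x y"
  with assms have "\<exists>!u. u \<in> Arr C \<and> Dom C u = Cod C f' \<and> Cod C u = Cod C y \<and> u \<cdot> f' = y \<and> u \<cdot> g' = x"
    unfolding pushout_def by (blast dest: square_sym)
  moreover have "Cod C f' = Cod C g'" "Cod C x = Cod C y"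
    using pushoutD[OF assms] squareD[OF s] by simp_all
  ultimately show "\<exists>!u. u \<in> Arr C \<and> Dom C u = Cod C g' \<and> Cod C u = Cod C x \<and> u \<cdot> g' = x \<and> u \<cdot> f' = y"
    by (simp add: conj_ac)
qed (use assms in \<open>blast intro: square_sym pushout_square\<close>)

lemma pullback_sym:
  assumes "pullback C f g f' g'"
  shows "pullback C g f g' f'"
  unfolding pullback_def
proof (intro conjI allI impI)
  fix x y assume s: "square C x y g f"
  with assms have "\<exists>!u. u \<in> Arr C \<and> Cod C u = Dom C f' \<and> Dom C u = Dom C y \<and> f' \<cdot> u = y \<and> g' \<cdot> u = x"
    unfolding pullback_def by (blast dest: square_sym)
  moreover have "Dom C f' = Dom C g'" "Dom C x = Dom C y"
    using pullbackD[OF assms] squareD[OF s] by simp_all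
  ultimately show "\<exists>!u. u \<in> Arr C \<and> Cod C u = Dom C g' \<and> Dom C u = Dom C x \<and> g' \<cdot> u = x \<and> f' \<cdot> u = y"
    by (simp add: conj_ac)
qed (use assms in \<open>blast intro: square_sym pullback_square\<close>)

lemma pushout_mediating:
  assumes "pushout C f g f' g'" "square C f g x y"
  obtains u where "u \<in> Arr C" "Dom C u = Cod C f'" "Cod C u = Cod C x" "u \<cdot> f' = x" "u \<cdot> g' = y"
  using assms unfolding pushout_def by metis

lemma pullback_mediating:
  assumes "pullback C f g f' g'" "square C x y f g"
  obtains u where "u \<in> Arr C" "Cod C u = Dom C f'" "Dom C u = Dom C x" "f' \<cdot> u = x" "g' \<cdot> u = y"
  using assms unfolding pullback_def by metis

lemma pushout_unique:
  assumes "pushout C f g f' g'"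
    and "u \<in> Arr C" "Dom C u = Cod C f'" "v \<in> Arr C" "Dom C v = Cod C f'"
    and "u \<cdot> f' = v \<cdot> f'" "u \<cdot> g' = v \<cdot> g'"
  shows "u = v"
proof -
  note p = pushoutD[OF assms(1)]
  have "square C f g (u \<cdot> f') (u \<cdot> g')"
    unfolding square_def using p assms by (simp add: Comp_in Dom_Comp Cod_Comp Comp_assoc)
  moreover have "Cod C u = Cod C v"
    using p assms by (metis Cod_Comp)
  ultimately show ?thesis
    using assms p unfolding pushout_def by (metis Cod_Comp)
qed

lemma pullback_unique:
  assumes "pullback C f g f' g'"
    and "u \<in> Arr C" "Cod C u = Dom C f'" "v \<in> Arr C" "Cod C v = Dom C f'"
    and "f' \<cdot> u = f' \<cdot> v" "g' \<cdot> u = g' \<cdot> v"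
  shows "u = v"
proof -
  note p = pullbackD[OF assms(1)]
  have "f \<cdot> (f' \<cdot> u) = g \<cdot> (g' \<cdot> u)"
    using p assms Comp_assoc by metis
  then have "square C (f' \<cdot> u) (g' \<cdot> u) f g"
    unfolding square_def using p assms by (simp add: Comp_in Dom_Comp Cod_Comp)
  moreover have "Dom C u = Dom C v"
    using p assms by (metis Dom_Comp)
  ultimately show ?thesis
    using assms p unfolding pullback_def by (metis Dom_Comp)
qed

lemma pushoutI:
  assumes "square C f g f' g'"
    and "\<And>x y. square C f g x y \<Longrightarrow>
      \<exists>u\<in>Arr C. Dom C u = Cod C f' \<and> u \<cdot> f' = x \<and> u \<cdot> g' = y"
    and "\<And>u v. \<lbrakk>u \<in> Arr C; v \<in> Arr C; Dom C u = Cod C f'; Dom C v = Cod C f';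
      u \<cdot> f' = v \<cdot> f'; u \<cdot> g' = v \<cdot> g'\<rbrakk> \<Longrightarrow> u = v"
  shows "pushout C f g f' g'"
  unfolding pushout_def
proof (intro conjI allI impI)
  fix x y assume "square C f g x y"
  with assms(2) obtain u where u: "u\<in>Arr C" "Dom C u = Cod C f'" "u \<cdot> f' = x" "u \<cdot> g' = y"
    by blast
  show "\<exists>!u. u \<in> Arr C \<and> Dom C u = Cod C f' \<and> Cod C u = Cod C x \<and> u \<cdot> f' = x \<and> u \<cdot> g' = y"
    using u squareD[OF assms(1)] by (intro ex1I[of _ u] conjI) (metis Cod_Comp assms(3))+
qed (fact assms(1))

lemma pullbackI:
  assumes "square C f' g' f g"
    and "\<And>x y. square C x y f g \<Longrightarrow>
      \<exists>u\<in>Arr C. Cod C u = Dom C f' \<and> f' \<cdot> u = x \<and> g' \<cdot> u = y"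
    and "\<And>u v. \<lbrakk>u \<in> Arr C; v \<in> Arr C; Cod C u = Dom C f'; Cod C v = Dom C f';
      f' \<cdot> u = f' \<cdot> v; g' \<cdot> u = g' \<cdot> v\<rbrakk> \<Longrightarrow> u = v"
  shows "pullback C f g f' g'"
  unfolding pullback_def
proof (intro conjI allI impI)
  fix x y assume "square C x y f g"
  with assms(2) obtain u where u: "u\<in>Arr C" "Cod C u = Dom C f'" "f' \<cdot> u = x" "g' \<cdot> u = y"
    by blast
  show "\<exists>!u. u \<in> Arr C \<and> Cod C u = Dom C f' \<and> Dom C u = Dom C x \<and> f' \<cdot> u = x \<and> g' \<cdot> u = y"
    using u squareD[OF assms(1)] by (intro ex1I[of _ u] conjI) (metis Dom_Comp assms(3))+
qed (fact assms(1))

lemma square_paste: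
  assumes 1: "square C f g f' g'" and 2: "square C f\<^sub>2 f' f\<^sub>3 h"
  shows "square C (f\<^sub>2 \<cdot> f) g f\<^sub>3 (h \<cdot> g')"
proof -
  note p = squareD[OF 1] and q = squareD[OF 2]
  have "f\<^sub>3 \<cdot> (f\<^sub>2 \<cdot> f) = h \<cdot> (f' \<cdot> f)"
    using square_precomp[OF 2, of f] p(1,6,9) q(5) by simp
  also have "\<dots> = (h \<cdot> g') \<cdot> g"
    using p q by (simp add: Comp_assoc)
  finally show ?thesis
    using p q unfolding square_def by (simp add: Comp_in Dom_Comp Cod_Comp)
qed

lemma pushout_paste:
  assumes 1: "pushout C f g f' g'" and 2: "pushout C f\<^sub>2 f' f\<^sub>3 h"
  shows "pushout C (f\<^sub>2 \<cdot> f) g f\<^sub>3 (h \<cdot> g')"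
proof (rule pushoutI)
  note p = pushoutD[OF 1] and q = pushoutD[OF 2]
  show "square C (f\<^sub>2 \<cdot> f) g f\<^sub>3 (h \<cdot> g')"
    using square_paste 1 2 pushout_square by blast
next
  note p = pushoutD[OF 1] and q = pushoutD[OF 2]
  fix x y assume s: "square C (f\<^sub>2 \<cdot> f) g x y"
  have x: "Cod C f\<^sub>2 = Dom C x" "x \<in> Arr C"
    using squareD[OF s] p q by (simp_all add: Cod_Comp)
  have "square C f g (x \<cdot> f\<^sub>2) y"
    using squareD[OF s] p q x unfolding square_def by (simp add: Comp_in Dom_Comp Cod_Comp Comp_assoc)
  then obtain u where u: "u \<in> Arr C" "Dom C u = Cod C f'" "Cod C u = Cod C (x \<cdot> f\<^sub>2)"
    "u \<cdot> f' = x \<cdot> f\<^sub>2" "u \<cdot> g' = y" by (rule pushout_mediating[OF 1])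
  have "square C f\<^sub>2 f' x u"
    using u x p q unfolding square_def by (simp add: Cod_Comp)
  then obtain v where "v \<in> Arr C" "Dom C v = Cod C f\<^sub>3" "v \<cdot> f\<^sub>3 = x" "v \<cdot> h = u"
    by (rule pushout_mediating[OF 2])
  then show "\<exists>u\<in>Arr C. Dom C u = Cod C f\<^sub>3 \<and> u \<cdot> f\<^sub>3 = x \<and> u \<cdot> (h \<cdot> g') = y"
    using u p q by (metis Comp_assoc)
next
  note p = pushoutD[OF 1] and q = pushoutD[OF 2]
  fix u v assume *: "u \<in> Arr C" "v \<in> Arr C" "Dom C u = Cod C f\<^sub>3" "Dom C v = Cod C f\<^sub>3"
    "u \<cdot> f\<^sub>3 = v \<cdot> f\<^sub>3" "u \<cdot> (h \<cdot> g') = v \<cdot> (h \<cdot> g')"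
  have "(u \<cdot> h) \<cdot> g' = (v \<cdot> h) \<cdot> g'"
    using * p q by (simp add: Comp_assoc)
  moreover have "(u \<cdot> h) \<cdot> f' = (v \<cdot> h) \<cdot> f'"
    using square_postcomp[OF pushout_square[OF 2]] * q by metis
  ultimately have "u \<cdot> h = v \<cdot> h"
    using * p q by (intro pushout_unique[OF 1, of "u \<cdot> h" "v \<cdot> h"]) (simp_all add: Comp_in Dom_Comp)
  then show "u = v"
    using pushout_unique[OF 2] * by blast
qed

lemma pushout_unpaste:
  assumes 1: "pushout C f g f' g'" and 2: "pushout C (f\<^sub>2 \<cdot> f) g f\<^sub>3 (h \<cdot> g')"
    and 3: "square C f\<^sub>2 f' f\<^sub>3 h"
  shows "pushout C f\<^sub>2 f' f\<^sub>3 h"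
proof (rule pushoutI[OF 3])
  fix x y assume s: "square C f\<^sub>2 f' x y"
  have "square C (f\<^sub>2 \<cdot> f) g x (y \<cdot> g')"
    using square_paste[OF pushout_square[OF 1] s] .
  then obtain u where u: "u \<in> Arr C" "Dom C u = Cod C f\<^sub>3" "u \<cdot> f\<^sub>3 = x" "u \<cdot> (h \<cdot> g') = y \<cdot> g'"
    by (rule pushout_mediating[OF 2])
  note p = pushoutD[OF 1] and q = squareD[OF 3] and r = squareD[OF s]
  have "(u \<cdot> h) \<cdot> f' = y \<cdot> f'" using square_postcomp[OF 3] u(1-3) r(9) by metis
  moreover have "(u \<cdot> h) \<cdot> g' = y \<cdot> g'" using u p q r by (simp add: Comp_assoc)
  ultimately have "u \<cdot> h = y"
    using u p q r by (intro pushout_unique[OF 1, of "u \<cdot> h" "y"]) (simp_all add: Comp_in Dom_Comp)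
  then show "\<exists>u\<in>Arr C. Dom C u = Cod C f\<^sub>3 \<and> u \<cdot> f\<^sub>3 = x \<and> u \<cdot> h = y" using u by blast
next
  note p = pushoutD[OF 1] and q = squareD[OF 3]
  fix u v assume *: "u \<in> Arr C" "v \<in> Arr C" "Dom C u = Cod C f\<^sub>3" "Dom C v = Cod C f\<^sub>3"
    "u \<cdot> f\<^sub>3 = v \<cdot> f\<^sub>3" "u \<cdot> h = v \<cdot> h"
  have "u \<cdot> (h \<cdot> g') = v \<cdot> (h \<cdot> g')" using * p q by (metis Comp_assoc)
  then show "u = v" using pushout_unique[OF 2] * by blast
qed

lemma pushout_factor:
  assumes 1: "pushout C f g f' g'" and 2: "pushout C (f\<^sub>2 \<cdot> f) g f\<^sub>3 w"
    and 3: "f\<^sub>2 \<in> Arr C" "Dom C f\<^sub>2 = Cod C f"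
  obtains h where "pushout C f\<^sub>2 f' f\<^sub>3 h" "h \<cdot> g' = w"
proof -
  note p = pushoutD[OF 1] and q = pushoutD[OF 2]
  have f3: "Dom C f\<^sub>3 = Cod C f\<^sub>2" using p q 3 by (metis Cod_Comp)
  have "square C f g (f\<^sub>3 \<cdot> f\<^sub>2) w"
    unfolding square_def using p q 3 f3 by (simp add: Comp_in Dom_Comp Cod_Comp Comp_assoc)
  then obtain h where h: "h \<in> Arr C" "Dom C h = Cod C f'" "Cod C h = Cod C (f\<^sub>3 \<cdot> f\<^sub>2)"
    "h \<cdot> f' = f\<^sub>3 \<cdot> f\<^sub>2" "h \<cdot> g' = w" by (rule pushout_mediating[OF 1])
  have "square C f\<^sub>2 f' f\<^sub>3 h"
    unfolding square_def using p q 3 f3 h by (simp add: Cod_Comp)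
  with h pushout_unpaste[OF 1] 2 have "pushout C f\<^sub>2 f' f\<^sub>3 h" by blast
  with h that show thesis by blast
qed

lemma pullback_paste:
  assumes 1: "pullback C f g f' g'" and 2: "pullback C g' h t s"
  shows "pullback C f (g \<cdot> h) (f' \<cdot> t) s"
proof (rule pullbackI)
  note p = pullbackD[OF 1] and q = pullbackD[OF 2]
  have "f \<cdot> (f' \<cdot> t) = g \<cdot> (g' \<cdot> t)"
    using square_precomp[OF pullback_square[OF 1], of t] p(5) q(1,6) by simp
  then have "f \<cdot> (f' \<cdot> t) = (g \<cdot> h) \<cdot> s"
    using p q by (simp add: Comp_assoc)
  then show "square C (f' \<cdot> t) s f (g \<cdot> h)"
    unfolding square_def using p q by (simp add: Comp_in Dom_Comp Cod_Comp)
next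
  note p = pullbackD[OF 1] and q = pullbackD[OF 2]
  fix x y assume s: "square C x y f (g \<cdot> h)"
  have y: "Cod C y = Dom C h" "y \<in> Arr C"
    using squareD[OF s] p q by (simp_all add: Dom_Comp)
  have "f \<cdot> x = g \<cdot> (h \<cdot> y)"
    using squareD(9)[OF s] p(4) q(4,8) y p(7) by (simp add: Comp_assoc)
  moreover have "Cod C (h \<cdot> y) = Dom C g" "Dom C (h \<cdot> y) = Dom C x" "h \<cdot> y \<in> Arr C"
    using squareD(5)[OF s] p(7) q(4,8) y by (simp_all add: Comp_in Dom_Comp Cod_Comp)
  ultimately have "square C x (h \<cdot> y) f g"
    using squareD(1,3,6)[OF s] p(4,8) unfolding square_def by simp
  then obtain u where u: "u \<in> Arr C" "Cod C u = Dom C f'" "Dom C u = Dom C x"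
    "f' \<cdot> u = x" "g' \<cdot> u = h \<cdot> y" by (rule pullback_mediating[OF 1])
  have "square C u y g' h"
    using u y p q squareD[OF s] unfolding square_def by simp
  then obtain v where "v \<in> Arr C" "Cod C v = Dom C t" "t \<cdot> v = u" "s \<cdot> v = y"
    by (rule pullback_mediating[OF 2])
  then show "\<exists>u\<in>Arr C. Cod C u = Dom C (f' \<cdot> t) \<and> (f' \<cdot> t) \<cdot> u = x \<and> s \<cdot> u = y"
    using u p q by (metis Comp_assoc Dom_Comp)
next
  note p = pullbackD[OF 1] and q = pullbackD[OF 2]
  fix u v assume *: "u \<in> Arr C" "v \<in> Arr C" "Cod C u = Dom C (f' \<cdot> t)" "Cod C v = Dom C (f' \<cdot> t)"
    "(f' \<cdot> t) \<cdot> u = (f' \<cdot> t) \<cdot> v" "s \<cdot> u = s \<cdot> v"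
  have d: "Cod C u = Dom C t" "Cod C v = Dom C t" using * p q by (simp_all add: Dom_Comp)
  have "f' \<cdot> (t \<cdot> u) = f' \<cdot> (t \<cdot> v)"
    using * d p q by (simp add: Comp_assoc)
  moreover have "g' \<cdot> (t \<cdot> u) = g' \<cdot> (t \<cdot> v)"
    using square_precomp[OF pullback_square[OF 2]] * d by metis
  ultimately have "t \<cdot> u = t \<cdot> v"
    using * d p q by (intro pullback_unique[OF 1, of "t \<cdot> u" "t \<cdot> v"]) (simp_all add: Comp_in Cod_Comp)
  then show "u = v"
    using pullback_unique[OF 2] * d by blast
qed

lemma pullback_unpaste:
  assumes 1: "pullback C f g f' g'" and 2: "pullback C f (g \<cdot> h) (f' \<cdot> t) s"
    and 3: "square C t s g' h"
  shows "pullback C g' h t s"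
proof (rule pullbackI[OF 3])
  note p = pullbackD[OF 1] and q = squareD[OF 3]
  fix x y assume s: "square C x y g' h"
  note r = squareD[OF s]
  have "f \<cdot> (f' \<cdot> x) = g \<cdot> (g' \<cdot> x)"
    using square_precomp[OF pullback_square[OF 1], of x] p(5) r(1,6) by simp
  then have "f \<cdot> (f' \<cdot> x) = (g \<cdot> h) \<cdot> y" using p q r by (simp add: Comp_assoc)
  then have "square C (f' \<cdot> x) y f (g \<cdot> h)"
    unfolding square_def using p q r by (simp add: Comp_in Dom_Comp Cod_Comp)
  then obtain u where u: "u \<in> Arr C" "Cod C u = Dom C (f' \<cdot> t)" "(f' \<cdot> t) \<cdot> u = f' \<cdot> x" "s \<cdot> u = y"
    by (rule pullback_mediating[OF 2])
  have d: "Cod C u = Dom C t" using u p q by (simp add: Dom_Comp)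
  have "f' \<cdot> (t \<cdot> u) = f' \<cdot> x" using u d p q by (simp add: Comp_assoc)
  moreover have "g' \<cdot> (t \<cdot> u) = g' \<cdot> x" using square_precomp[OF 3] u(1,4) d r(9) by metis
  ultimately have "t \<cdot> u = x"
    using u d p q r by (intro pullback_unique[OF 1, of "t \<cdot> u" "x"]) (simp_all add: Comp_in Cod_Comp)
  then show "\<exists>u\<in>Arr C. Cod C u = Dom C t \<and> t \<cdot> u = x \<and> s \<cdot> u = y" using u d by blast
next
  note p = pullbackD[OF 1] and q = squareD[OF 3]
  fix u v assume *: "u \<in> Arr C" "v \<in> Arr C" "Cod C u = Dom C t" "Cod C v = Dom C t"
    "t \<cdot> u = t \<cdot> v" "s \<cdot> u = s \<cdot> v"
  have "(f' \<cdot> t) \<cdot> u = (f' \<cdot> t) \<cdot> v" using * p q by (simp add: Comp_assoc)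
  then show "u = v" using * p q by (intro pullback_unique[OF 2, of u v]) (simp_all add: Dom_Comp)
qed

lemma pullback_mono_Comp:
  assumes m: "mono_arr C m" and k: "k \<in> Arr C" "Cod C k = Dom C m"
  shows "pullback C m (m \<cdot> k) k (Id C (Dom C k))"
proof (rule pullbackI)
  have mA: "m \<in> Arr C" using m by (simp add: mono_arr_def)
  have "Dom C k \<in> Obj C" using k Dom_in by blast
  note I = Id_in[OF this] Dom_Id[OF this] Cod_Id[OF this]
  have "(m \<cdot> k) \<cdot> Id C (Dom C k) = m \<cdot> k"
    using Comp_Id[of "m \<cdot> k"] mA k by (simp add: Comp_in Dom_Comp)
  then show "square C k (Id C (Dom C k)) m (m \<cdot> k)"
    unfolding square_def using mA k I by (simp add: Comp_in Dom_Comp Cod_Comp)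
  fix x y assume s: "square C x y m (m \<cdot> k)"
  note r = squareD[OF s]
  have y: "Cod C y = Dom C k" using r mA k by (simp add: Dom_Comp)
  have "m \<cdot> x = m \<cdot> (k \<cdot> y)" using r y mA k by (simp add: Comp_assoc)
  moreover have "k \<cdot> y \<in> Arr C" "Cod C (k \<cdot> y) = Dom C m" "Dom C (k \<cdot> y) = Dom C y"
    using r y k by (simp_all add: Comp_in Dom_Comp Cod_Comp)
  ultimately have "x = k \<cdot> y" using m r unfolding mono_arr_def by metis
  moreover have "Id C (Dom C k) \<cdot> y = y" using Id_Comp r y by metis
  ultimately show "\<exists>u\<in>Arr C. Cod C u = Dom C k \<and> k \<cdot> u = x \<and> Id C (Dom C k) \<cdot> u = y"
    using r y by blast
next
  fix u v assume "u \<in> Arr C" "v \<in> Arr C" "Cod C u = Dom C k" "Cod C v = Dom C k"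
    "Id C (Dom C k) \<cdot> u = Id C (Dom C k) \<cdot> v"
  then show "u = v" using Id_Comp by metis
qed

lemma mono_Id: "X \<in> Obj C \<Longrightarrow> mono_arr C (Id C X)"
  unfolding mono_arr_def by (metis Dom_Id Id_Comp Id_in)

lemma iso_Id: "X \<in> Obj C \<Longrightarrow> iso_arr C (Id C X)"
  unfolding iso_arr_def by (metis Cod_Id Comp_Id Dom_Id Id_in)

lemma pullback_Id:
  assumes f: "f \<in> Arr C"
  shows "pullback C (Id C (Cod C f)) f f (Id C (Dom C f))"
  using pullback_mono_Comp[OF mono_Id[OF Cod_in[OF f]] f] f by (simp add: Dom_Id Id_Comp Cod_in)

lemma pullback_mono:
  assumes "mono_arr C m"
  shows "pullback C m m (Id C (Dom C m)) (Id C (Dom C m))"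
proof -
  have m: "m \<in> Arr C" using assms by (simp add: mono_arr_def)
  note D = Dom_in[OF m]
  show ?thesis
    using pullback_mono_Comp[OF assms Id_in[OF D] Cod_Id[OF D]] m D by (simp add: Dom_Id Comp_Id)
qed

lemma pushout_Id:
  assumes f: "f \<in> Arr C"
  shows "pushout C (Id C (Dom C f)) f f (Id C (Cod C f))"
proof (rule pushoutI)
  show "square C (Id C (Dom C f)) f f (Id C (Cod C f))"
    unfolding square_def using f
    by (simp add: Id_in Dom_in Cod_in Dom_Id Cod_Id Id_Comp Comp_Id)
  fix x y assume "square C (Id C (Dom C f)) f x y"
  note r = squareD[OF this]
  have "Dom C x = Dom C f" using r f by (simp add: Cod_Id Dom_in)
  then have "y \<cdot> f = x" using r f Comp_Id by metis
  moreover have "y \<cdot> Id C (Cod C f) = y" using r Comp_Id by metis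
  ultimately show "\<exists>u\<in>Arr C. Dom C u = Cod C f \<and> u \<cdot> f = x \<and> u \<cdot> Id C (Cod C f) = y"
    using r by metis
next
  fix u v assume "u \<in> Arr C" "v \<in> Arr C" "Dom C u = Cod C f" "Dom C v = Cod C f"
    "u \<cdot> Id C (Cod C f) = v \<cdot> Id C (Cod C f)"
  then show "u = v" using Comp_Id by metis
qed

lemma pushout_Id_iso:
  assumes 1: "pushout C (Id C X) f g n" and X: "X \<in> Obj C"
  shows "iso_arr C n"
proof -
  note p = pushoutD[OF 1]
  have f: "Dom C f = X" "Dom C g = X" using p X by (simp_all add: Dom_Id Cod_Id)
  have n: "n \<cdot> f = g" using p f by (metis Comp_Id)
  have "square C (Id C X) f f (Id C (Cod C f))"
    using pushout_square[OF pushout_Id[of f]] p f by simp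
  then obtain u where u: "u \<in> Arr C" "Dom C u = Cod C g" "Cod C u = Cod C f"
    "u \<cdot> g = f" "u \<cdot> n = Id C (Cod C f)" by (rule pushout_mediating[OF 1])
  have "n \<cdot> u = Id C (Cod C n)"
  proof (rule pushout_unique[OF 1])
    show "(n \<cdot> u) \<cdot> g = Id C (Cod C n) \<cdot> g" using u p n by (metis Comp_assoc Id_Comp)
    show "(n \<cdot> u) \<cdot> n = Id C (Cod C n) \<cdot> n" using u p by (metis Comp_assoc Id_Comp Comp_Id)
  qed (use u p in \<open>simp_all add: Comp_in Dom_Comp Id_in Dom_Id Cod_in\<close>)
  then show ?thesis
    unfolding iso_arr_def using p u by (intro conjI bexI[of _ u]) auto
qed

lemma pullback_iso:
  assumes 1: "pullback C f g f' g'" and i: "iso_arr C i" "Cod C i = Dom C f'"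
  shows "pullback C f g (f' \<cdot> i) (g' \<cdot> i)"
proof -
  obtain j where ij: "i \<in> Arr C" "j \<in> Arr C" "Dom C j = Cod C i" "Cod C j = Dom C i"
    "j \<cdot> i = Id C (Dom C i)" "i \<cdot> j = Id C (Cod C i)"
    using i by (auto simp: iso_arr_def)
  note p = pullbackD[OF 1]
  show ?thesis
  proof (rule pullbackI)
    have "f \<cdot> (f' \<cdot> i) = g \<cdot> (g' \<cdot> i)" using p i ij by (metis Comp_assoc)
    then show "square C (f' \<cdot> i) (g' \<cdot> i) f g"
      unfolding square_def using p i ij by (simp add: Comp_in Dom_Comp Cod_Comp)
    fix x y assume "square C x y f g"
    then obtain u where u: "u \<in> Arr C" "Cod C u = Dom C f'" "f' \<cdot> u = x" "g' \<cdot> u = y"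
      by (rule pullback_mediating[OF 1])
    have "i \<cdot> (j \<cdot> u) = u" using u i ij by (metis Comp_assoc Id_Comp)
    moreover have ju: "j \<cdot> u \<in> Arr C" "Cod C (j \<cdot> u) = Dom C i"
      using u i ij by (simp_all add: Comp_in Cod_Comp)
    ultimately have "(f' \<cdot> i) \<cdot> (j \<cdot> u) = x" "(g' \<cdot> i) \<cdot> (j \<cdot> u) = y"
      using u p i ij by (simp_all add: Comp_assoc)
    then show "\<exists>u\<in>Arr C. Cod C u = Dom C (f' \<cdot> i) \<and> (f' \<cdot> i) \<cdot> u = x \<and> (g' \<cdot> i) \<cdot> u = y"
      using ju p i ij by (intro bexI[of _ "j \<cdot> u"]) (simp_all add: Dom_Comp)
  next
    fix u v assume *: "u \<in> Arr C" "v \<in> Arr C" "Cod C u = Dom C (f' \<cdot> i)" "Cod C v = Dom C (f' \<cdot> i)"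
      "(f' \<cdot> i) \<cdot> u = (f' \<cdot> i) \<cdot> v" "(g' \<cdot> i) \<cdot> u = (g' \<cdot> i) \<cdot> v"
    have d: "Cod C u = Dom C i" "Cod C v = Dom C i" using * p i ij by (simp_all add: Dom_Comp)
    have "f' \<cdot> (i \<cdot> u) = f' \<cdot> (i \<cdot> v)" "g' \<cdot> (i \<cdot> u) = g' \<cdot> (i \<cdot> v)"
      using * d p i ij by (simp_all add: Comp_assoc)
    then have "i \<cdot> u = i \<cdot> v"
      using * d i ij by (intro pullback_unique[OF 1, of "i \<cdot> u" "i \<cdot> v"]) (simp_all add: Comp_in Cod_Comp)
    then show "u = v" using * d ij by (metis Comp_assoc Id_Comp)
  qed
qed

end

section \<open>M-adhesive categories\<close>

context M_adhesive_category
begin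

lemma M_arr: "m \<in> M \<Longrightarrow> m \<in> Arr C"
  using M_mono by (simp add: mono_arr_def)

lemma M_Id: "X \<in> Obj C \<Longrightarrow> Id C X \<in> M"
  by (simp add: iso_Id iso_M)

text \<open>This and the following lemma are the two directions of the van Kampen property; here the
  cube has the given square as bottom and as a front face, and an identity pushout on top.\<close>

lemma pushout_pullback:
  assumes m: "m \<in> M" and po: "pushout C m f g n"
  shows "pullback C g n m f"
proof -
  note p = pushoutD[OF po]
  let ?A = "Id C (Dom C m)" and ?X = "Id C (Cod C f)"
  have n: "n \<in> M" using M_pushout[OF m po] .
  have obj: "Dom C m \<in> Obj C" "Cod C f \<in> Obj C" using p Dom_in Cod_in by simp_all
  have mA: "m \<cdot> ?A = m" "f \<cdot> ?A = f" using p Comp_Id by metis+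
  have "pullback C m m ?A ?A"
    using pullback_mono[OF M_mono[OF m]] .
  moreover have "pullback C ?X f f ?A"
    using pullback_Id[OF p(2)] p(5) by simp
  moreover have po': "pushout C ?A f f ?X"
    using pushout_Id[OF p(2)] p(5) by simp
  moreover have "square C f m n g"
    using square_sym pushout_square[OF po] by blast
  moreover have "square C ?X ?X n n"
    using p obj by (simp add: square_def Id_in Dom_Id Cod_Id)
  moreover have "?X \<in> M" using M_Id obj by blast
  ultimately have "pullback C n g f m"
    using VK[OF m po] m n pushout_square[OF po']
    unfolding vertical_weak_VK_def by blast
  then show ?thesis by (rule pullback_sym)
qed

lemma pushout_stable:
  assumes m: "m \<in> M" and po: "pushout C m f g n" and d: "d \<in> M"
    and 1: "pullback C d g g' b" and 2: "pullback C d n n' c" and 3: "pullback C b m m' a"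
    and f': "f' \<in> Arr C" "Dom C f' = Dom C m'" "Cod C f' = Dom C n'"
    and comm: "n' \<cdot> f' = g' \<cdot> m'"
  shows "pushout C m' f' g' n'"
proof -
  note p = pushoutD[OF po] and q1 = pullbackD[OF 1] and q2 = pullbackD[OF 2] and q3 = pullbackD[OF 3]
  have b: "b \<in> M" and c: "c \<in> M" using M_pullback d 1 2 by blast+
  have n: "n \<in> M" using M_pushout[OF m po] .
  have outer: "pullback C d (n \<cdot> f) (n' \<cdot> f') a"
    using pullback_paste[OF 1 3] p(9) comm by simp
  note q4 = pullbackD[OF outer]
  have cf: "c \<cdot> f' \<in> Arr C" "Dom C (c \<cdot> f') = Dom C f'" "Cod C (c \<cdot> f') = Dom C n"
    "f \<cdot> a \<in> Arr C" "Dom C (f \<cdot> a) = Dom C f'" "Cod C (f \<cdot> a) = Dom C n"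
    using f' q2(2,5,7) q3(2,5,7) p(2,5,7) by (simp_all add: Comp_in Dom_Comp Cod_Comp)
  have "n \<cdot> (c \<cdot> f') = d \<cdot> (n' \<cdot> f')"
    using square_precomp[OF pullback_square[OF 2] f'(1,3)] by simp
  also have "\<dots> = n \<cdot> (f \<cdot> a)"
    using q4(9) p(2,4,5,7) q3(2,5,7) by (simp add: Comp_assoc)
  finally have "c \<cdot> f' = f \<cdot> a"
    using M_mono[OF n] cf unfolding mono_arr_def by metis
  then have sq: "square C f' a c f"
    using f' p(2,5,7) q2(2,5,7) q3 unfolding square_def by simp
  have "pullback C c f f' a"
    using pullback_unpaste[OF 2 outer] pullback_unpaste[OF pullback_sym] sq 2 outer by blast
  moreover have "square C m' f' g' n'"
    using f' q1 q2 q3(1,6) comm unfolding square_def by simp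
  ultimately show ?thesis
    using VK[OF m po] b c d 1 2 3 pullback_square[OF 1] pullback_square[OF 2]
    unfolding vertical_weak_VK_def by blast
qed

lemma pushout_restrict:
  assumes l: "l \<in> M" and po: "pushout C l d (q \<cdot> a) h" and q: "q \<in> M"
    and a: "a \<in> Arr C" "Dom C a = Cod C l" "Cod C a = Dom C q"
  obtains z r w where "pushout C l z a r" "pullback C q h r w" "w \<cdot> z = d"
proof -
  note p = pushoutD[OF po]
  note l' = M_arr[OF l] and q' = M_arr[OF q]
  have "Cod C q = Cod C h" using p(8) a q' by (simp add: Cod_Comp)
  then obtain r w where pb: "pullback C q h r w" using pullback_ex[OF q p(4)] by blast
  note s = pullbackD[OF pb]
  have w: "w \<in> M" using M_pullback[OF q pb] .
  have "q \<cdot> (a \<cdot> l) = h \<cdot> d" using p(9) a l' q' by (simp add: Comp_assoc)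
  then have "square C (a \<cdot> l) d q h"
    using p(2,4,5,7) a l' s(3,8) by (simp add: square_def Comp_in Dom_Comp Cod_Comp)
  then obtain z where z: "z \<in> Arr C" "Cod C z = Dom C r" "Dom C z = Dom C (a \<cdot> l)"
    "r \<cdot> z = a \<cdot> l" "w \<cdot> z = d" by (rule pullback_mediating[OF pb])
  let ?L = "Id C (Cod C l)" and ?K = "Id C (Dom C l)"
  have lK: "l \<cdot> ?K = l" using Comp_Id l' by blast
  have 1: "pullback C q (q \<cdot> a) a ?L"
    using pullback_mono_Comp[OF M_mono[OF q] a(1,3)] a(2) by simp
  have 3: "pullback C ?L l l ?K"
    using pullback_Id[OF l'] .
  have "pushout C l z a r"
    using pushout_stable[OF l po q 1 pb 3 z(1)] z a l' by (simp add: Dom_Comp)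
  with pb z that show thesis by blast
qed

lemma pushout_complement_map:
  assumes l: "l \<in> M" and 1: "pushout C l k m n" and 2: "pushout C l k' m n'"
  obtains i where "i \<in> Arr C" "Dom C i = Cod C k" "Cod C i = Cod C k'" "i \<cdot> k = k'" "n' \<cdot> i = n"
proof -
  note p1 = pushoutD[OF 1] and p2 = pushoutD[OF 2]
  note l' = M_arr[OF l]
  have n: "n \<in> M" and n': "n' \<in> M" using M_pushout l 1 2 by blast+
  have "Cod C n = Cod C n'" using p1 p2 by simp
  then obtain s t where pb: "pullback C n n' s t" using pullback_ex n p2(4) by blast
  note q = pullbackD[OF pb]
  have "square C k k' n n'" using p1 p2 by (simp add: square_def)
  then obtain x where x: "x \<in> Arr C" "Cod C x = Dom C s" "Dom C x = Dom C k" "s \<cdot> x = k" "t \<cdot> x = k'"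
    by (rule pullback_mediating[OF pb])
  have obj: "Dom C l \<in> Obj C" using Dom_in l' by blast
  have "pushout C (Id C (Dom C l)) x k s"
    using x p1(2,5) q obj
    by (intro pushout_stable[OF l 2 n pullback_sym[OF pushout_pullback[OF l 1]] pb pullback_mono[OF M_mono[OF l]]])
      (simp_all add: Dom_Id Comp_Id)
  then have "iso_arr C s" using pushout_Id_iso obj by blast
  then obtain j where j: "s \<in> Arr C" "j \<in> Arr C" "Dom C j = Cod C s" "Cod C j = Dom C s"
    "j \<cdot> s = Id C (Dom C s)" "s \<cdot> j = Id C (Cod C s)"
    by (auto simp: iso_arr_def)
  have "j \<cdot> k = x" using x j by (metis Comp_assoc Id_Comp)
  then have "(t \<cdot> j) \<cdot> k = k'" using x j q(2,5) p1(2,5,7) q(6) by (simp add: Comp_assoc)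
  moreover have "n' \<cdot> (t \<cdot> j) = n \<cdot> (s \<cdot> j)"
    using square_precomp[OF pullback_square[OF pb], of j] j by simp
  moreover have "n \<cdot> (s \<cdot> j) = n" using j q(3,6) by (simp add: Comp_Id)
  ultimately show thesis
    using that[of "t \<cdot> j"] q(2,5,6,7) p1(7) p2(7) j by (simp add: Comp_in Dom_Comp Cod_Comp)
qed

lemma pushout_restrict_complement:
  assumes l: "l \<in> M" and po: "pushout C l d (q \<cdot> a) h" and q: "q \<in> M" "Dom C q = Cod C a"
    and 1: "pushout C l z a r"
  obtains w where "w \<in> M" "pushout C r w q h" "w \<cdot> z = d" "Dom C w = Cod C z"
proof -
  note p1 = pushoutD[OF 1] and p2 = pushoutD[OF po]
  note q' = M_arr[OF q(1)]
  have r: "r \<in> M" using M_pushout[OF l 1] .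
  obtain z' r' w' where *: "pushout C l z' a r'" "pullback C q h r' w'" "w' \<cdot> z' = d"
    using pushout_restrict[OF l po q(1) p1(3)] p1(6) q(2) by metis
  note p3 = pushoutD[OF *(1)] and p4 = pullbackD[OF *(2)]
  obtain i where i: "i \<in> Arr C" "Dom C i = Cod C z" "Cod C i = Cod C z'" "i \<cdot> z = z'" "r' \<cdot> i = r"
    using pushout_complement_map[OF l 1 *(1)] by blast
  have w: "w' \<cdot> i \<in> Arr C" "Dom C (w' \<cdot> i) = Cod C z" "Cod C (w' \<cdot> i) = Dom C h"
    using i p3(7) p4(2,5,7) by (simp_all add: Comp_in Dom_Comp Cod_Comp)
  have wz: "(w' \<cdot> i) \<cdot> z = d"
    using i *(3) p1(2) p3(7) p4(2,5) by (simp add: Comp_assoc)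
  have "q \<cdot> r = h \<cdot> (w' \<cdot> i)"
    using square_precomp[OF pullback_square[OF *(2)], of i] i p3(7) by simp
  then have "square C (w' \<cdot> i) r h q"
    using w q q' p1(4,7,8) p4(3,4,8) unfolding square_def by simp
  moreover have "pushout C ((w' \<cdot> i) \<cdot> z) l h (q \<cdot> a)"
    using pushout_sym[OF po] wz by simp
  ultimately have "pushout C (w' \<cdot> i) r h q"
    using pushout_unpaste[OF pushout_sym[OF 1]] by blast
  then have po': "pushout C r (w' \<cdot> i) q h" by (rule pushout_sym)
  moreover have "w' \<cdot> i \<in> M" using M_pullback[OF q(1) pushout_pullback[OF r po']] .
  ultimately show thesis using that w wz by blast
qed

section \<open>Transport of nested conditions\<close>

lemma sat_Shift:
  assumes E': "pair_factorization C M E'"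
    and "cond_over C (Dom C b) c" "b \<in> Arr C" "m \<in> M" "Dom C m = Cod C b"
  shows "sat C M m (Shift C M E' b c) \<longleftrightarrow> sat C M (m \<cdot> b) c"
  using assms(2-)
proof (induction c arbitrary: b m)
  case (CEx a c)
  then have a: "a \<in> Arr C" "Dom C a = Dom C b" "cond_over C (Cod C a) c" by auto
  note b = CEx.prems(2) and m = CEx.prems(3,4) and mA = M_arr[OF CEx.prems(3)]
  show ?case
  proof
    assume "sat C M m (Shift C M E' b (CEx a c))"
    then obtain a' b' w where *: "(a', b') \<in> E'" "b' \<in> M" "square C a b b' a'"
      "w \<in> M" "Dom C w = Cod C a'" "w \<cdot> a' = m" "sat C M w (Shift C M E' b' c)"
      by auto
    note s = squareD[OF *(3)]
    have wb: "w \<cdot> b' \<in> M" "Dom C (w \<cdot> b') = Cod C a"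
      using M_Comp[OF *(2,4)] *(5) M_arr[OF *(4)] s by (simp_all add: Dom_Comp)
    have "sat C M (w \<cdot> b') c"
      using CEx.IH[of b' w] * s a by simp
    moreover have "(w \<cdot> b') \<cdot> a = m \<cdot> b"
      using square_postcomp[OF *(3) M_arr[OF *(4)]] *(5,6) s(8) by simp
    ultimately show "sat C M (m \<cdot> b) (CEx a c)" using wb by auto
  next
    assume "sat C M (m \<cdot> b) (CEx a c)"
    then obtain q where q: "q \<in> M" "Dom C q = Cod C a" "q \<cdot> a = m \<cdot> b" "sat C M q c"
      by auto
    note qA = M_arr[OF q(1)]
    have "Cod C q = Cod C m" using q(2,3) qA a mA b m by (metis Cod_Comp)
    then have "\<exists>a' b' w. (a', b') \<in> E' \<and> w \<in> M \<and> Cod C a' = Dom C w \<and> m = w \<cdot> a' \<and> q = w \<cdot> b'"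
      using E' qA mA unfolding pair_factorization_def by simp
    then obtain a' b' w where *: "(a', b') \<in> E'" "w \<in> M" "Cod C a' = Dom C w"
      "m = w \<cdot> a'" "q = w \<cdot> b'"
      by blast
    have **: "a' \<in> Arr C" "b' \<in> Arr C" "Cod C b' = Dom C w"
      using E' *(1,3) unfolding pair_factorization_def by auto
    note * = * **
    note wA = M_arr[OF *(2)]
    have b': "b' \<in> M" using M_decomp[of b' w] * q(1) by simp
    have d: "Dom C b' = Cod C a" "Dom C a' = Cod C b" using * wA q m by (simp_all add: Dom_Comp)
    have "w \<cdot> (b' \<cdot> a) = w \<cdot> (a' \<cdot> b)"
      using q(3) * wA d a b by (simp add: Comp_assoc)
    then have "b' \<cdot> a = a' \<cdot> b"
      using M_mono[OF *(2)] * d a b unfolding mono_arr_def by (metis Cod_Comp Comp_in Dom_Comp)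
    then have sq: "square C a b b' a'"
      using * d a b by (simp add: square_def)
    have "sat C M w (Shift C M E' b' c)"
      using CEx.IH[of b' w] * d a q by simp
    then show "sat C M m (Shift C M E' b (CEx a c))"
      using * b' sq by simp metis
  qed
qed auto

lemma cond_over_Shift:
  assumes "cond_over C (Dom C b) c" "b \<in> Arr C"
  shows "cond_over C (Cod C b) (Shift C M E' b c)"
  using assms
proof (induction c arbitrary: b)
  case (CEx a c)
  have "cond_over C (Cod C a') (Shift C M E' b' c)" if "square C a b b' a'" for a' b'
    using CEx squareD[OF that] by (metis cond_over.simps(2))
  then show ?case using CEx.prems by (auto simp: square_def Cod_in)
qed (auto simp: Cod_in)

lemma derived_rule_pushouts:
  assumes "l \<in> M" "Dom C l = Dom C r" "has_pushout_complement C r a"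
  obtains b l' r' z where "derived_rule C l r a = (b, l', r')"
    "pushout C r z a r'" "pushout C l z b l'"
proof -
  obtain z r' where 1: "pushout C r z a r'" using assms(3) by (auto simp: has_pushout_complement_def)
  note p = pushoutD[OF 1]
  obtain b l' where 2: "pushout C l z b l'" using pushout_ex[OF assms(1) p(2)] p(5) assms(2) by auto
  let ?P = "\<lambda>(b, l', r'). \<exists>z. pushout C r z a r' \<and> pushout C l z b l'"
  have "?P (derived_rule C l r a)"
    unfolding derived_rule_def using 1 2 by (intro someI[of ?P "(b, l', r')"]) auto
  then show thesis using that by (cases "derived_rule C l r a") auto
qed

lemma sat_Left:
  assumes "l \<in> M" "r \<in> M" "cond_over C (Cod C r) c"
    "pushout C l d m g" "pushout C r d n h"
  shows "sat C M m (Left C l r c) \<longleftrightarrow> sat C M n c"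
  using assms
proof (induction c arbitrary: l r d m g n h)
  case (CEx a c)
  note l = CEx.prems(1) and r = CEx.prems(2) and 1 = CEx.prems(4) and 2 = CEx.prems(5)
  have a: "a \<in> Arr C" "Dom C a = Cod C r" "cond_over C (Cod C a) c" using CEx.prems(3) by auto
  have lr: "Dom C l = Dom C r" using pushoutD(5)[OF 1] pushoutD(5)[OF 2] by simp
  show ?case
  proof
    assume s: "sat C M m (Left C l r (CEx a c))"
    then have "has_pushout_complement C r a" by (auto split: if_splits)
    then obtain b l' r' z where *: "derived_rule C l r a = (b, l', r')"
      "pushout C r z a r'" "pushout C l z b l'"
      using derived_rule_pushouts[OF l lr] by blast
    with s obtain q where q: "q \<in> M" "Dom C q = Cod C b" "q \<cdot> b = m" "sat C M q (Left C l' r' c)"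
      by (auto split: if_splits)
    note p2 = pushoutD[OF *(2)] and p3 = pushoutD[OF *(3)]
    obtain w where w: "w \<in> M" "pushout C l' w q g" "w \<cdot> z = d" "Dom C w = Cod C z"
      using pushout_restrict_complement[OF l _ q(1,2) *(3)] 1 q(3) by metis
    have r': "r' \<in> M" and l': "l' \<in> M" using M_pushout * l r by blast+
    obtain q' where q': "pushout C w r' h q'" "q' \<cdot> a = n"
      using pushout_factor[OF pushout_sym[OF *(2)], of w h n] pushout_sym[OF 2] w M_arr by metis
    have "q' \<in> M" using M_pushout[OF w(1) q'(1)] .
    moreover have "sat C M q' c"
      using CEx.IH[OF l' r' _ w(2) pushout_sym[OF q'(1)]] q(4) a p2(8) by simp
    ultimately show "sat C M n (CEx a c)"
      using q'(2) p2(8) pushoutD(6,7)[OF q'(1)] by auto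
  next
    assume s: "sat C M n (CEx a c)"
    then obtain q where q: "q \<in> M" "Dom C q = Cod C a" "q \<cdot> a = n" "sat C M q c"
      by auto
    have po: "pushout C r d (q \<cdot> a) h" using 2 q(3) by simp
    have hpc: "has_pushout_complement C r a"
      using pushout_restrict[OF r po q(1) a(1,2)] q(2) unfolding has_pushout_complement_def by metis
    then obtain b l' r' z where *: "derived_rule C l r a = (b, l', r')"
      "pushout C r z a r'" "pushout C l z b l'"
      using derived_rule_pushouts[OF l lr] by blast
    note p2 = pushoutD[OF *(2)] and p3 = pushoutD[OF *(3)]
    obtain w where w: "w \<in> M" "pushout C r' w q h" "w \<cdot> z = d" "Dom C w = Cod C z"
      using pushout_restrict_complement[OF r po q(1,2) *(2)] by metis
    have r': "r' \<in> M" and l': "l' \<in> M" using M_pushout * l r by blast+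
    obtain q' where q': "pushout C w l' g q'" "q' \<cdot> b = m"
      using pushout_factor[OF pushout_sym[OF *(3)], of w g m] pushout_sym[OF 1] w M_arr by metis
    have "q' \<in> M" using M_pushout[OF w(1) q'(1)] .
    moreover have "sat C M q' (Left C l' r' c)"
      using CEx.IH[OF l' r' _ pushout_sym[OF q'(1)] w(2)] q(4) a p2(8) by simp
    ultimately show "sat C M m (Left C l r (CEx a c))"
      using hpc * q'(2) p3(8) pushoutD(6,7)[OF q'(1)] by auto
  qed
qed auto

end

section \<open>The generalized concurrent rule\<close>

locale generalized_concurrent = M_adhesive_category C M
  for C :: "('o, 'a) category" (structure) and M :: "'a set" +
  fixes E' :: "('a \<times> 'a) set"
    and \<rho>\<^sub>1 \<rho>\<^sub>2 \<rho>\<^sub>E \<rho>\<^sub>k :: "'a rule"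
    and e\<^sub>1 e\<^sub>2 e\<^sub>1'' r\<^sub>1' e\<^sub>2'' l\<^sub>2' e\<^sub>1' l\<^sub>1' e\<^sub>2' r\<^sub>2' k\<^sub>1 k\<^sub>2 :: 'a
    and k u\<^sub>1 u\<^sub>2 v\<^sub>1 v\<^sub>2 p p' k' l' r' :: 'a
  assumes factorization: "pair_factorization C M E'"
    and rule\<^sub>1: "is_rule C M \<rho>\<^sub>1" and rule\<^sub>2: "is_rule C M \<rho>\<^sub>2"
    and dependency: "E_dependency_relation C M E' \<rho>\<^sub>1 \<rho>\<^sub>2 e\<^sub>1 e\<^sub>2"
    and concurrent:
      "concurrent_diagram C \<rho>\<^sub>1 \<rho>\<^sub>2 e\<^sub>1 e\<^sub>2 e\<^sub>1'' r\<^sub>1' e\<^sub>2'' l\<^sub>2' e\<^sub>1' l\<^sub>1' e\<^sub>2' r\<^sub>2' k\<^sub>1 k\<^sub>2"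
    and \<rho>\<^sub>E_def: "\<rho>\<^sub>E = concurrent_rule C M E' \<rho>\<^sub>1 \<rho>\<^sub>2 e\<^sub>2 r\<^sub>1' e\<^sub>1' l\<^sub>1' r\<^sub>2' k\<^sub>1 k\<^sub>2"
    and kernel: "common_kernel C M \<rho>\<^sub>1 \<rho>\<^sub>2 k u\<^sub>1 u\<^sub>2 v\<^sub>1 v\<^sub>2"
    and embedding: "kernel_embedding C M e\<^sub>1'' e\<^sub>2'' k\<^sub>1 k\<^sub>2 u\<^sub>1 u\<^sub>2 p"
    and gcr: "gcr_diagram C M \<rho>\<^sub>E e\<^sub>1' e\<^sub>2' k v\<^sub>1 v\<^sub>2 p p' k' l' r'"
    and \<rho>\<^sub>k_def: "\<rho>\<^sub>k = generalized_concurrent_rule \<rho>\<^sub>E l' r'"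
begin

lemma rule_M: "lmor \<rho>\<^sub>1 \<in> M" "rmor \<rho>\<^sub>1 \<in> M" "lmor \<rho>\<^sub>2 \<in> M" "rmor \<rho>\<^sub>2 \<in> M"
  using rule\<^sub>1 rule\<^sub>2 by (simp_all add: is_rule_def)

lemma e\<^sub>2_M: "e\<^sub>2 \<in> M"
  using dependency by (simp add: E_dependency_relation_def)

lemma concurrent_pushouts:
  "pushout C (rmor \<rho>\<^sub>1) e\<^sub>1'' e\<^sub>1 r\<^sub>1'" "pushout C (lmor \<rho>\<^sub>2) e\<^sub>2'' e\<^sub>2 l\<^sub>2'"
  "pushout C (lmor \<rho>\<^sub>1) e\<^sub>1'' e\<^sub>1' l\<^sub>1'" "pushout C (rmor \<rho>\<^sub>2) e\<^sub>2'' e\<^sub>2' r\<^sub>2'"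
  and concurrent_pullback: "pullback C r\<^sub>1' l\<^sub>2' k\<^sub>1 k\<^sub>2"
  using concurrent by (simp_all add: concurrent_diagram_def)

lemma primed_M: "r\<^sub>1' \<in> M" "l\<^sub>2' \<in> M" "l\<^sub>1' \<in> M" "r\<^sub>2' \<in> M"
  using M_pushout rule_M concurrent_pushouts by blast+

lemma k\<^sub>2_M: "k\<^sub>2 \<in> M"
  using M_pullback primed_M concurrent_pullback by blast

lemma gcr_pushout: "pushout C k p p' k'"
  and gcr_M: "l' \<in> M" "r' \<in> M"
  and gcr_Dom: "Dom C l' = Cod C k'" "Dom C r' = Cod C k'"
  and l'_eqs: "l' \<cdot> p' = e\<^sub>1' \<cdot> v\<^sub>1" "l' \<cdot> k' = l\<^sub>1' \<cdot> k\<^sub>1"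
  and r'_eq: "r' \<cdot> k' = r\<^sub>2' \<cdot> k\<^sub>2"
  using gcr by (simp_all add: gcr_diagram_def \<rho>\<^sub>E_def concurrent_rule_def)

lemma k'_M: "k' \<in> M"
  using M_pushout[OF _ gcr_pushout] kernel by (simp add: common_kernel_def)

lemma k'_arr: "k' \<in> Arr C" and k'_Dom: "Dom C k' = Dom C k\<^sub>1"
  using pushoutD[OF gcr_pushout] embedding by (simp_all add: kernel_embedding_def)

lemma \<rho>\<^sub>k_sel: "lmor \<rho>\<^sub>k = l'" "rmor \<rho>\<^sub>k = r'" "acond \<rho>\<^sub>k = acond \<rho>\<^sub>E"
  by (simp_all add: \<rho>\<^sub>k_def generalized_concurrent_rule_def)

lemma sat_acond:
  assumes m: "m \<in> M" and h: "h \<in> M"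
    and 1: "pushout C l\<^sub>1' c\<^sub>1 m g\<^sub>1" and 2: "pushout C r\<^sub>1' c\<^sub>1 h h\<^sub>1"
  shows "sat C M m (acond \<rho>\<^sub>k) \<longleftrightarrow>
    sat C M (m \<cdot> e\<^sub>1') (acond \<rho>\<^sub>1) \<and> sat C M (h \<cdot> e\<^sub>2) (acond \<rho>\<^sub>2)"
proof -
  note q1 = pushoutD[OF concurrent_pushouts(1)] and q2 = pushoutD[OF concurrent_pushouts(2)]
    and q3 = pushoutD[OF concurrent_pushouts(3)] and p1 = pushoutD[OF 1] and p2 = pushoutD[OF 2]
  have E: "Cod C e\<^sub>2 = Cod C r\<^sub>1'"
    using q2 pullbackD[OF concurrent_pullback] by simp
  have "sat C M m (Shift C M E' e\<^sub>1' (acond \<rho>\<^sub>1)) \<longleftrightarrow> sat C M (m \<cdot> e\<^sub>1') (acond \<rho>\<^sub>1)"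
    using sat_Shift[OF factorization _ q3(3) m] rule\<^sub>1 q3(6,8) p1(6) by (simp add: is_rule_def)
  moreover have "sat C M h (Shift C M E' e\<^sub>2 (acond \<rho>\<^sub>2)) \<longleftrightarrow> sat C M (h \<cdot> e\<^sub>2) (acond \<rho>\<^sub>2)"
    using sat_Shift[OF factorization _ q2(3) h] rule\<^sub>2 q2(6) p2(6) E by (simp add: is_rule_def)
  moreover have "sat C M m (Left C l\<^sub>1' r\<^sub>1' (Shift C M E' e\<^sub>2 (acond \<rho>\<^sub>2))) \<longleftrightarrow>
      sat C M h (Shift C M E' e\<^sub>2 (acond \<rho>\<^sub>2))"
    using cond_over_Shift[of e\<^sub>2 "acond \<rho>\<^sub>2" E'] rule\<^sub>2 q2(3,6) E
    by (intro sat_Left[OF primed_M(3,1) _ 1 2]) (simp add: is_rule_def)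
  ultimately show ?thesis
    by (simp add: \<rho>\<^sub>k_sel \<rho>\<^sub>E_def concurrent_rule_def)
qed

lemma synthesis:
  assumes "E_related C M \<rho>\<^sub>1 \<rho>\<^sub>2 e\<^sub>1 e\<^sub>2 e\<^sub>1'' r\<^sub>1' e\<^sub>2'' l\<^sub>2' m\<^sub>1 m\<^sub>2 G\<^sub>0 G\<^sub>1 G\<^sub>2"
  shows "\<exists>m. transformation C M \<rho>\<^sub>k m G\<^sub>0 G\<^sub>2"
proof -
  obtain g\<^sub>1 h\<^sub>1 g\<^sub>2 h\<^sub>2 n\<^sub>2 h c\<^sub>1 c\<^sub>2 where
    t1: "transformation_diagram C M \<rho>\<^sub>1 m\<^sub>1 (c\<^sub>1 \<cdot> e\<^sub>1'') g\<^sub>1 h\<^sub>1 (h \<cdot> e\<^sub>1)" "Cod C g\<^sub>1 = G\<^sub>0" and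
    t2: "transformation_diagram C M \<rho>\<^sub>2 (h \<cdot> e\<^sub>2) (c\<^sub>2 \<cdot> e\<^sub>2'') g\<^sub>2 h\<^sub>2 n\<^sub>2" "Cod C h\<^sub>2 = G\<^sub>2" and
    h: "h \<in> M" and po1: "pushout C r\<^sub>1' c\<^sub>1 h h\<^sub>1" and po2: "pushout C l\<^sub>2' c\<^sub>2 h g\<^sub>2"
    using assms unfolding E_related_def by blast
  note q1 = pushoutD[OF concurrent_pushouts(1)] and q2 = pushoutD[OF concurrent_pushouts(2)]
    and p1 = pushoutD[OF po1] and p2 = pushoutD[OF po2] and q = pullbackD[OF concurrent_pullback]
  have pb1: "pullback C h h\<^sub>1 r\<^sub>1' c\<^sub>1" and pb2: "pullback C h g\<^sub>2 l\<^sub>2' c\<^sub>2"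
    using pushout_pullback primed_M po1 po2 by blast+
  have c: "c\<^sub>1 \<in> M" "c\<^sub>2 \<in> M" and hM: "h\<^sub>1 \<in> M" "g\<^sub>2 \<in> M"
    using M_pullback h pb1 pb2 M_pushout primed_M po1 po2 by blast+
  obtain m where m: "pushout C c\<^sub>1 l\<^sub>1' g\<^sub>1 m" "m \<cdot> e\<^sub>1' = m\<^sub>1"
    using pushout_factor[OF pushout_sym[OF concurrent_pushouts(3)], of c\<^sub>1 g\<^sub>1 m\<^sub>1]
      t1(1) p1(2,5) q1(7) by (metis transformation_diagram_def pushout_sym)
  obtain n where n: "pushout C c\<^sub>2 r\<^sub>2' h\<^sub>2 n"
    using pushout_factor[OF pushout_sym[OF concurrent_pushouts(4)], of c\<^sub>2 h\<^sub>2 n\<^sub>2]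
      t2(1) p2(2,5) q2(7) by (metis transformation_diagram_def pushout_sym)
  have mM: "m \<in> M" using M_pushout c m by blast
  obtain x\<^sub>1 x\<^sub>2 where pbD: "pullback C h\<^sub>1 g\<^sub>2 x\<^sub>1 x\<^sub>2"
    using pullback_ex[OF hM(1) p2(4)] p1(8) p2(8) by auto
  note x = pullbackD[OF pbD]
  have hr: "h\<^sub>1 \<cdot> (c\<^sub>1 \<cdot> k\<^sub>1) = g\<^sub>2 \<cdot> (c\<^sub>2 \<cdot> k\<^sub>2)"
    using square_precomp[OF pushout_square[OF po1] q(1)] square_precomp[OF pushout_square[OF po2] q(2)]
      q p1(5-7) p2(5-7) Comp_assoc M_arr[OF h] by metis
  have "square C (c\<^sub>1 \<cdot> k\<^sub>1) (c\<^sub>2 \<cdot> k\<^sub>2) h\<^sub>1 g\<^sub>2"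
    using hr q(1-7) p1(2,4,5,7) p2(2,4,5,7) x(8)
    by (simp add: square_def Comp_in Dom_Comp Cod_Comp)
  then obtain s where s: "s \<in> Arr C" "Cod C s = Dom C x\<^sub>1" "Dom C s = Dom C (c\<^sub>1 \<cdot> k\<^sub>1)"
    "x\<^sub>1 \<cdot> s = c\<^sub>1 \<cdot> k\<^sub>1" "x\<^sub>2 \<cdot> s = c\<^sub>2 \<cdot> k\<^sub>2"
    by (rule pullback_mediating[OF pbD])
  have s': "Dom C s = Dom C k\<^sub>1" "Dom C s = Dom C k\<^sub>2" "Cod C s = Dom C x\<^sub>2"
    using s(2,3) q(1,5,6) p1(2,5) x(5) by (simp_all add: Dom_Comp)
  have po3: "pushout C k\<^sub>2 s c\<^sub>2 x\<^sub>2"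
    using pushout_stable[OF primed_M(1) po1 hM(2) pullback_sym[OF pb2] pullback_sym[OF pbD]
        pullback_sym[OF concurrent_pullback] s(1) s'(2,3) s(5)] .
  have po4: "pushout C k\<^sub>1 s c\<^sub>1 x\<^sub>1"
    using pushout_stable[OF primed_M(2) po2 hM(1) pullback_sym[OF pb1] pbD
        concurrent_pullback s(1) s'(1) s(2) s(4)] .
  have po5: "pushout C (l\<^sub>1' \<cdot> k\<^sub>1) s m (g\<^sub>1 \<cdot> x\<^sub>1)" and po6: "pushout C (r\<^sub>2' \<cdot> k\<^sub>2) s n (h\<^sub>2 \<cdot> x\<^sub>2)"
    using pushout_paste po3 po4 pushout_sym m(1) n by blast+
  obtain d y where po7: "pushout C k' s d y"
    using pushout_ex[OF k'_M s(1)] s'(1) k'_Dom by auto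
  obtain g where g: "pushout C l' d m g" "g \<cdot> y = g\<^sub>1 \<cdot> x\<^sub>1"
    using pushout_factor[OF po7, of l' m] po5 l'_eqs(2) M_arr[OF gcr_M(1)] gcr_Dom(1) by metis
  obtain g' where g': "pushout C r' d n g'" "g' \<cdot> y = h\<^sub>2 \<cdot> x\<^sub>2"
    using pushout_factor[OF po7, of r' n] po6 r'_eq M_arr[OF gcr_M(2)] gcr_Dom(2) by metis
  have "sat C M m (acond \<rho>\<^sub>k)"
    using sat_acond[OF mM h pushout_sym[OF m(1)] po1] t1(1) t2(1) m(2)
    by (simp add: transformation_diagram_def)
  then have "transformation_diagram C M \<rho>\<^sub>k m d g g' n"
    using mM g(1) g'(1) by (simp add: transformation_diagram_def \<rho>\<^sub>k_sel)
  moreover have "Cod C g = G\<^sub>0" "Cod C g' = G\<^sub>2"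
    using t1(2) t2(2) pushoutD(8)[OF g(1)] pushoutD(8)[OF g'(1)] pushoutD(8)[OF m(1)] pushoutD(8)[OF n]
    by simp_all
  ultimately show ?thesis unfolding transformation_def by blast
qed

text \<open>The pushout \<open>K'\<close> of \<open>V\<close> and \<open>K\<close> over \<open>K\<^sub>\<inter>\<close> is stable under pulling back along the pullback of
  \<open>l\<^sub>1'\<close>, and this turns \<open>V\<close> into \<open>K\<^sub>\<inter>\<close> because \<open>K\<^sub>\<inter>\<close> is the pullback of \<open>V\<close> and \<open>K\<^sub>1\<close> over \<open>L\<^sub>1\<close>.
  What remains of \<open>K'\<close> is \<open>K\<close>.\<close>

lemma enhancement_pullback: "pullback C l' l\<^sub>1' k' k\<^sub>1"
proof -
  note q3 = pushoutD[OF concurrent_pushouts(3)] and q = pullbackD[OF concurrent_pullback]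
    and pg = pushoutD[OF gcr_pushout]
  have k: "k \<in> M" and pbk: "pullback C v\<^sub>1 (lmor \<rho>\<^sub>1) k u\<^sub>1"
    using kernel by (simp_all add: common_kernel_def)
  have p: "p \<in> Arr C" "Dom C p = Dom C u\<^sub>1" "Cod C p = Dom C k\<^sub>1" "k\<^sub>1 \<cdot> p = e\<^sub>1'' \<cdot> u\<^sub>1"
    using embedding M_arr by (simp_all add: kernel_embedding_def)
  have k1A: "k\<^sub>1 \<in> Arr C" using q by simp
  have l'A: "l' \<in> Arr C" using M_arr[OF gcr_M(1)] .
  have "Cod C (l' \<cdot> k') = Cod C (l\<^sub>1' \<cdot> k\<^sub>1)" using l'_eqs(2) by simp
  then have codl: "Cod C l' = Cod C l\<^sub>1'"
    using l'A k'_arr gcr_Dom(1) k1A q3(2,4,5,7) pushoutD[OF concurrent_pushouts(1)] q(6)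
    by (simp add: Cod_Comp)
  obtain s t where pb: "pullback C l' l\<^sub>1' s t"
    using pullback_ex[OF gcr_M(1) q3(4) codl] by blast
  note x = pullbackD[OF pb]
  have sM: "s \<in> M" using M_pullback[OF primed_M(3) pullback_sym[OF pb]] .
  have k1C: "Cod C k\<^sub>1 = Dom C l\<^sub>1'"
    using q3(2,4,5,7) pushoutD(7)[OF concurrent_pushouts(1)] q(6) by simp
  have "square C k' k\<^sub>1 l' l\<^sub>1'"
    using l'A k'_arr k'_Dom gcr_Dom(1) k1A k1C codl q3(4) l'_eqs(2) by (simp add: square_def)
  then obtain n where n: "n \<in> Arr C" "Cod C n = Dom C s" "Dom C n = Dom C k'"
    "s \<cdot> n = k'" "t \<cdot> n = k\<^sub>1"
    by (rule pullback_mediating[OF pb])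
  have np: "n \<cdot> p \<in> Arr C" "Dom C (n \<cdot> p) = Dom C p" "Cod C (n \<cdot> p) = Dom C s"
    using n p k'_Dom by (simp_all add: Comp_in Dom_Comp Cod_Comp)
  have "pullback C e\<^sub>1' l\<^sub>1' (lmor \<rho>\<^sub>1) e\<^sub>1''"
    using pushout_pullback[OF rule_M(1) concurrent_pushouts(3)] .
  then have "pullback C l\<^sub>1' (l' \<cdot> p') (e\<^sub>1'' \<cdot> u\<^sub>1) k"
    using pullback_paste pullback_sym pbk l'_eqs(1) by metis
  moreover have tnp: "t \<cdot> (n \<cdot> p) = e\<^sub>1'' \<cdot> u\<^sub>1"
    using n p x(2,5) k'_Dom Comp_assoc by metis
  moreover have snp: "s \<cdot> (n \<cdot> p) = p' \<cdot> k"
    using n p x(1) k'_Dom pg(9) by (simp flip: Comp_assoc)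
  then have "square C (n \<cdot> p) k s p'"
    using np p pg x(1,6) gcr_Dom(1) by (simp add: square_def)
  ultimately have 1: "pullback C s p' (n \<cdot> p) k"
    using pullback_unpaste[OF pullback_sym[OF pb], of p' "n \<cdot> p" k] by metis
  have "pullback C s (s \<cdot> n) n (Id C (Dom C n))"
    using pullback_mono_Comp[OF M_mono[OF sM] n(1,2)] .
  then have 2: "pullback C s k' n (Id C (Dom C n))" using n(4) by simp
  have I: "Dom C k \<in> Obj C" "k \<in> Arr C" using Dom_in M_arr[OF k] by blast+
  have pk: "Dom C p = Dom C k" using pg(5) by simp
  have "pushout C (Id C (Dom C k)) p (n \<cdot> p) n"
  proof (rule pushout_stable[OF k gcr_pushout sM 1 2 pullback_mono[OF M_mono[OF k]] p(1)])
    show "Dom C p = Dom C (Id C (Dom C k))" using I pk by (simp add: Dom_Id)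
    show "Cod C p = Dom C n" using p(3) n(3) k'_Dom by simp
    show "n \<cdot> p = (n \<cdot> p) \<cdot> Id C (Dom C k)" using Comp_Id np pk by metis
  qed
  then have "iso_arr C n" using pushout_Id_iso I by blast
  then show ?thesis using pullback_iso[OF pb] n by metis
qed

lemma analysis:
  assumes t: "transformation C M \<rho>\<^sub>k m G\<^sub>0 G\<^sub>2" and t1: "transformation C M \<rho>\<^sub>1 (m \<cdot> e\<^sub>1') G\<^sub>0 G\<^sub>1"
  shows "\<exists>m\<^sub>2. E_related C M \<rho>\<^sub>1 \<rho>\<^sub>2 e\<^sub>1 e\<^sub>2 e\<^sub>1'' r\<^sub>1' e\<^sub>2'' l\<^sub>2' (m \<cdot> e\<^sub>1') m\<^sub>2 G\<^sub>0 G\<^sub>1 G\<^sub>2"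
proof -
  note q1 = pushoutD[OF concurrent_pushouts(1)] and q2 = pushoutD[OF concurrent_pushouts(2)]
    and q3 = pushoutD[OF concurrent_pushouts(3)] and q4 = pushoutD[OF concurrent_pushouts(4)]
    and q = pullbackD[OF concurrent_pullback]
  obtain d g g' n where m: "m \<in> M" "sat C M m (acond \<rho>\<^sub>k)" and
    po1: "pushout C l' d m g" and po2: "pushout C r' d n g'" and G2: "Cod C g' = G\<^sub>2"
    using t unfolding transformation_def transformation_diagram_def \<rho>\<^sub>k_sel by blast
  obtain d\<^sub>1 g\<^sub>1 h\<^sub>1 n\<^sub>1 where t1': "transformation_diagram C M \<rho>\<^sub>1 (m \<cdot> e\<^sub>1') d\<^sub>1 g\<^sub>1 h\<^sub>1 n\<^sub>1" and
    G0: "Cod C g\<^sub>1 = G\<^sub>0" and G1: "Cod C h\<^sub>1 = G\<^sub>1"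
    using t1 unfolding transformation_def by blast
  then have po3: "pushout C (lmor \<rho>\<^sub>1) d\<^sub>1 (m \<cdot> e\<^sub>1') g\<^sub>1" and po4: "pushout C (rmor \<rho>\<^sub>1) d\<^sub>1 n\<^sub>1 h\<^sub>1"
    by (simp_all add: transformation_diagram_def)
  note p1 = pushoutD[OF po1] and p2 = pushoutD[OF po2]
  have "Cod C l' = Cod C l\<^sub>1'" using pullbackD(8)[OF enhancement_pullback] .
  then have "Dom C m = Cod C e\<^sub>1'" using p1(6) q3(8) by simp
  then obtain c\<^sub>1 where c1: "c\<^sub>1 \<in> M" "pushout C l\<^sub>1' c\<^sub>1 m g\<^sub>1" "c\<^sub>1 \<cdot> e\<^sub>1'' = d\<^sub>1" "Dom C c\<^sub>1 = Cod C e\<^sub>1''"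
    using pushout_restrict_complement[OF rule_M(1) po3 m(1) _ concurrent_pushouts(3)] by metis
  obtain h where "pushout C c\<^sub>1 r\<^sub>1' h\<^sub>1 h" and he: "h \<cdot> e\<^sub>1 = n\<^sub>1"
    using pushout_factor[OF pushout_sym[OF concurrent_pushouts(1)], of c\<^sub>1 h\<^sub>1 n\<^sub>1]
      pushout_sym[OF po4] c1 M_arr by metis
  then have po5: "pushout C r\<^sub>1' c\<^sub>1 h h\<^sub>1" and h: "h \<in> M"
    using pushout_sym M_pushout[OF c1(1)] by blast+
  have gM: "g \<in> M" "g\<^sub>1 \<in> M" using M_pushout gcr_M(1) po1 primed_M(3) c1(2) by blast+
  obtain y x\<^sub>1 where pbD: "pullback C g g\<^sub>1 y x\<^sub>1"
    using pullback_ex[OF gM(1) M_arr[OF gM(2)]] p1(8) pushoutD(8)[OF c1(2)] by auto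
  note x = pullbackD[OF pbD] and p5 = pushoutD[OF po5] and pc = pushoutD[OF c1(2)]
  note ep = pullbackD[OF enhancement_pullback]
  have "g \<cdot> (d \<cdot> k') = m \<cdot> (l' \<cdot> k')"
    using square_precomp[OF pushout_square[OF po1] k'_arr] gcr_Dom(1) by simp
  also have "\<dots> = g\<^sub>1 \<cdot> (c\<^sub>1 \<cdot> k\<^sub>1)"
    using square_precomp[OF pushout_square[OF c1(2)], of k\<^sub>1] ep l'_eqs(2) by simp
  finally have "square C (d \<cdot> k') (c\<^sub>1 \<cdot> k\<^sub>1) g g\<^sub>1"
    using p1(2,4,5,7) pc(2,4,5,7) ep(1,2,5,6,7) x(8)
    by (simp add: square_def Comp_in Dom_Comp Cod_Comp)
  then obtain s where s: "s \<in> Arr C" "Cod C s = Dom C y" "Dom C s = Dom C (d \<cdot> k')"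
    "y \<cdot> s = d \<cdot> k'" "x\<^sub>1 \<cdot> s = c\<^sub>1 \<cdot> k\<^sub>1"
    by (rule pullback_mediating[OF pbD])
  have s': "Dom C s = Dom C k\<^sub>1" "Dom C s = Dom C k'" "Cod C s = Dom C x\<^sub>1"
    using s(2,3) p1(2,5) ep(1,5,6) x(5) by (simp_all add: Dom_Comp)
  have pbm: "pullback C m g l' d" "pullback C m g\<^sub>1 l\<^sub>1' c\<^sub>1"
    using pushout_pullback gcr_M(1) po1 primed_M(3) c1(2) by blast+
  have po6: "pushout C k\<^sub>1 s c\<^sub>1 x\<^sub>1"
    using pushout_stable[OF gcr_M(1) po1 gM(2) pullback_sym[OF pbm(2)] pullback_sym[OF pbD]
        pullback_sym[OF enhancement_pullback] s(1) s'(1,3) s(5)] .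
  have po7: "pushout C k' s d y"
    using pushout_stable[OF primed_M(3) c1(2) gM(1) pullback_sym[OF pbm(1)] pbD
        enhancement_pullback s(1) s'(2) s(2) s(4)] .
  have po8: "pushout C (r\<^sub>2' \<cdot> k\<^sub>2) s n (g' \<cdot> y)"
    using pushout_paste[OF po7 po2] r'_eq by simp
  have po9: "pushout C (l\<^sub>2' \<cdot> k\<^sub>2) s h (h\<^sub>1 \<cdot> x\<^sub>1)"
    using pushout_paste[OF po6 po5] q(9) by simp
  obtain c\<^sub>2 x\<^sub>2 where po10: "pushout C k\<^sub>2 s c\<^sub>2 x\<^sub>2"
    using pushout_ex[OF k\<^sub>2_M s(1)] s'(1) q(5) by auto
  have kC: "Dom C l\<^sub>2' = Cod C k\<^sub>2" "Dom C r\<^sub>2' = Cod C k\<^sub>2"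
    using q(7) q2(7) q4(7) by simp_all
  obtain h\<^sub>2 where h2: "pushout C r\<^sub>2' c\<^sub>2 n h\<^sub>2"
    using pushout_factor[OF po10 po8 q4(4) kC(2)] by blast
  obtain g\<^sub>2 where g2: "pushout C l\<^sub>2' c\<^sub>2 h g\<^sub>2"
    using pushout_factor[OF po10 po9 q(4) kC(1)] by blast
  have "pushout C (lmor \<rho>\<^sub>2) (c\<^sub>2 \<cdot> e\<^sub>2'') (h \<cdot> e\<^sub>2) g\<^sub>2"
    "pushout C (rmor \<rho>\<^sub>2) (c\<^sub>2 \<cdot> e\<^sub>2'') (n \<cdot> e\<^sub>2') h\<^sub>2"
    using pushout_paste pushout_sym concurrent_pushouts g2 h2 by blast+
  moreover have "h \<cdot> e\<^sub>2 \<in> M"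
    using M_Comp e\<^sub>2_M h q2(8) q(8) p5(6) by simp
  moreover have "sat C M (h \<cdot> e\<^sub>2) (acond \<rho>\<^sub>2)"
    using sat_acond[OF m(1) h c1(2) po5] m(2) by simp
  ultimately have "transformation_diagram C M \<rho>\<^sub>2 (h \<cdot> e\<^sub>2) (c\<^sub>2 \<cdot> e\<^sub>2'') g\<^sub>2 h\<^sub>2 (n \<cdot> e\<^sub>2')"
    by (simp add: transformation_diagram_def)
  moreover have "Cod C g\<^sub>2 = G\<^sub>1" "Cod C h\<^sub>2 = G\<^sub>2"
    using G1 G2 p2(8) p5(8) pushoutD(8)[OF g2] pushoutD(8)[OF h2] by simp_all
  ultimately show ?thesis
    unfolding E_related_def using t1' G0 G1 h he c1(3) po5 g2 by blast
qed

lemma applicable_iff: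
  assumes t: "transformation C M \<rho>\<^sub>k m G\<^sub>0 G\<^sub>2"
  shows "(\<exists>G\<^sub>1. transformation C M \<rho>\<^sub>1 (m \<cdot> e\<^sub>1') G\<^sub>0 G\<^sub>1) \<longleftrightarrow> applicable C M \<rho>\<^sub>1 (m \<cdot> e\<^sub>1')"
proof -
  obtain d g where po: "pushout C l' d m g" "Cod C g = G\<^sub>0"
    using t unfolding transformation_def transformation_diagram_def \<rho>\<^sub>k_sel by blast
  note p = pushoutD[OF po(1)] and q3 = pushoutD[OF concurrent_pushouts(3)]
  have "Dom C m = Cod C e\<^sub>1'"
    using pullbackD(8)[OF enhancement_pullback] p(6) q3(8) by simp
  then have "Cod C (m \<cdot> e\<^sub>1') = G\<^sub>0" using p(3,8) q3(3) po(2) by (simp add: Cod_Comp)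
  then show ?thesis
    unfolding transformation_def applicable_def transformation_diagram_def
    by (metis pushoutD(8))
qed

end

lemma E_related_first_step:
  "E_related C M \<rho>\<^sub>1 \<rho>\<^sub>2 e\<^sub>1 e\<^sub>2 e\<^sub>1'' r\<^sub>1' e\<^sub>2'' l\<^sub>2' m\<^sub>1 m\<^sub>2 G\<^sub>0 G\<^sub>1 G\<^sub>2 \<Longrightarrow> transformation C M \<rho>\<^sub>1 m\<^sub>1 G\<^sub>0 G\<^sub>1"
  unfolding E_related_def transformation_def by blast

theorem theorem1:
  fixes C :: "('o, 'a) category" and M :: "'a set" and E' :: "('a \<times> 'a) set"
    and \<rho>\<^sub>1 \<rho>\<^sub>2 \<rho>\<^sub>E \<rho>\<^sub>k :: "'a rule"
    and e\<^sub>1 e\<^sub>2 e\<^sub>1'' r\<^sub>1' e\<^sub>2'' l\<^sub>2' e\<^sub>1' l\<^sub>1' e\<^sub>2' r\<^sub>2' k\<^sub>1 k\<^sub>2 :: 'a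
    and k u\<^sub>1 u\<^sub>2 v\<^sub>1 v\<^sub>2 p p' k' l' r' :: 'a
  assumes "M_adhesive_category C M"
    and "M_effective_unions C M"
    and "pair_factorization C M E'"
    and "is_rule C M \<rho>\<^sub>1" and "is_rule C M \<rho>\<^sub>2"
    and "E_dependency_relation C M E' \<rho>\<^sub>1 \<rho>\<^sub>2 e\<^sub>1 e\<^sub>2"
    and "concurrent_diagram C \<rho>\<^sub>1 \<rho>\<^sub>2 e\<^sub>1 e\<^sub>2 e\<^sub>1'' r\<^sub>1' e\<^sub>2'' l\<^sub>2' e\<^sub>1' l\<^sub>1' e\<^sub>2' r\<^sub>2' k\<^sub>1 k\<^sub>2"
    and "\<rho>\<^sub>E = concurrent_rule C M E' \<rho>\<^sub>1 \<rho>\<^sub>2 e\<^sub>2 r\<^sub>1' e\<^sub>1' l\<^sub>1' r\<^sub>2' k\<^sub>1 k\<^sub>2"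
    and "common_kernel C M \<rho>\<^sub>1 \<rho>\<^sub>2 k u\<^sub>1 u\<^sub>2 v\<^sub>1 v\<^sub>2"
    and "compatible_kernel C \<rho>\<^sub>1 \<rho>\<^sub>2 e\<^sub>1 e\<^sub>2 u\<^sub>1 u\<^sub>2"
    and "kernel_embedding C M e\<^sub>1'' e\<^sub>2'' k\<^sub>1 k\<^sub>2 u\<^sub>1 u\<^sub>2 p"
    and "gcr_diagram C M \<rho>\<^sub>E e\<^sub>1' e\<^sub>2' k v\<^sub>1 v\<^sub>2 p p' k' l' r'"
    and "\<rho>\<^sub>k = generalized_concurrent_rule \<rho>\<^sub>E l' r'"
  shows "(\<forall>m\<^sub>1 m\<^sub>2 G\<^sub>0 G\<^sub>1 G\<^sub>2.
        E_related C M \<rho>\<^sub>1 \<rho>\<^sub>2 e\<^sub>1 e\<^sub>2 e\<^sub>1'' r\<^sub>1' e\<^sub>2'' l\<^sub>2' m\<^sub>1 m\<^sub>2 G\<^sub>0 G\<^sub>1 G\<^sub>2 \<longrightarrow>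
        (\<exists>m. transformation C M \<rho>\<^sub>k m G\<^sub>0 G\<^sub>2)) \<and>
      (\<forall>m G\<^sub>0 G\<^sub>2.
        transformation C M \<rho>\<^sub>k m G\<^sub>0 G\<^sub>2 \<longrightarrow>
        ((\<exists>m\<^sub>1 m\<^sub>2 G\<^sub>1. m\<^sub>1 = m \<cdot>\<^bsub>C\<^esub> e\<^sub>1' \<and>
            E_related C M \<rho>\<^sub>1 \<rho>\<^sub>2 e\<^sub>1 e\<^sub>2 e\<^sub>1'' r\<^sub>1' e\<^sub>2'' l\<^sub>2' m\<^sub>1 m\<^sub>2 G\<^sub>0 G\<^sub>1 G\<^sub>2) \<longleftrightarrow>
          (\<exists>G\<^sub>1. transformation C M \<rho>\<^sub>1 (m \<cdot>\<^bsub>C\<^esub> e\<^sub>1') G\<^sub>0 G\<^sub>1)) \<and>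
        ((\<exists>G\<^sub>1. transformation C M \<rho>\<^sub>1 (m \<cdot>\<^bsub>C\<^esub> e\<^sub>1') G\<^sub>0 G\<^sub>1) \<longleftrightarrow>
          applicable C M \<rho>\<^sub>1 (m \<cdot>\<^bsub>C\<^esub> e\<^sub>1')))"
proof -
  interpret M_adhesive_category C M by fact
  interpret generalized_concurrent C M E' \<rho>\<^sub>1 \<rho>\<^sub>2 \<rho>\<^sub>E \<rho>\<^sub>k e\<^sub>1 e\<^sub>2 e\<^sub>1'' r\<^sub>1' e\<^sub>2'' l\<^sub>2' e\<^sub>1' l\<^sub>1' e\<^sub>2' r\<^sub>2'
    k\<^sub>1 k\<^sub>2 k u\<^sub>1 u\<^sub>2 v\<^sub>1 v\<^sub>2 p p' k' l' r'
    by unfold_locales fact+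
  show ?thesis
  proof (intro conjI allI impI)
    fix m G\<^sub>0 G\<^sub>2
    assume t: "transformation C M \<rho>\<^sub>k m G\<^sub>0 G\<^sub>2"
    show "(\<exists>m\<^sub>1 m\<^sub>2 G\<^sub>1. m\<^sub>1 = m \<cdot>\<^bsub>C\<^esub> e\<^sub>1' \<and>
        E_related C M \<rho>\<^sub>1 \<rho>\<^sub>2 e\<^sub>1 e\<^sub>2 e\<^sub>1'' r\<^sub>1' e\<^sub>2'' l\<^sub>2' m\<^sub>1 m\<^sub>2 G\<^sub>0 G\<^sub>1 G\<^sub>2) \<longleftrightarrow>
      (\<exists>G\<^sub>1. transformation C M \<rho>\<^sub>1 (m \<cdot>\<^bsub>C\<^esub> e\<^sub>1') G\<^sub>0 G\<^sub>1)"
      using E_related_first_step analysis[OF t] by metis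
    show "(\<exists>G\<^sub>1. transformation C M \<rho>\<^sub>1 (m \<cdot>\<^bsub>C\<^esub> e\<^sub>1') G\<^sub>0 G\<^sub>1) \<longleftrightarrow> applicable C M \<rho>\<^sub>1 (m \<cdot>\<^bsub>C\<^esub> e\<^sub>1')"
      using applicable_iff[OF t] .
  qed (rule synthesis)
qed

end
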